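(* Let $n,m\ge 0$, let $Q_1,Q_2$ be two conics in $\mathbb{C}\mathbb{P}^2$ which are tangent to each other at two points, let $L_1,\dots,L_n$ be $n$ lines tangent to one of the two conics and let $L'_1,\dots,L'_m$ be $m$ lines tangent to the other conic. Put $$T_{n,m}=Q_1\cup Q_2\cup\Big(\bigcup_{i=1}^n L_i\Big)\cup\Big(\bigcup_{j=1}^m L'_j\Big).$$ Then the fundamental group $\pi_1(\mathbb{C}\mathbb{P}^2-T_{n,m})$ is big.
   Context: A group is called big if it contains a free subgroup generated by two or more (free) generators, i.e. a free subgroup of rank at least $2$. Conics are smooth; the arrangement is real (all components are defined by real equations), the lines are pairwise distinct, and the case where some line is tangent to both conics (at one of their tangency points) is excluded. *)

theory Defs
  imports "HOL-Analysis.Analysis" "HOL-Algebra.Group"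
begin

section \<open>The complex projective plane\<close>

definition proportional :: "complex^3 \<Rightarrow> complex^3 \<Rightarrow> bool" where
  "proportional x y \<longleftrightarrow> x \<noteq> 0 \<and> y \<noteq> 0 \<and> (\<exists>c. y = c *s x)"

lemma part_equivp_proportional: "part_equivp proportional"
proof (rule part_equivpI)
  show "\<exists>x. proportional x x"
    by (rule exI[of _ "axis 1 1"])
      (auto simp: proportional_def axis_eq_0_iff intro!: exI[of _ 1])
  show "symp proportional"
  proof (rule sympI)
    fix x y assume "proportional x y"
    then obtain c where c: "x \<noteq> 0" "y \<noteq> 0" "y = c *s x"
      by (auto simp: proportional_def)
    then have "c \<noteq> 0" by auto
    then have "x = inverse c *s y" using c by simp
    then show "proportional y x" using c unfolding proportional_def by blast
  qed
  show "transp proportional"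
    by (rule transpI) (auto simp: proportional_def)
qed

quotient_type cp2 = "complex^3" / partial: proportional
  by (rule part_equivp_proportional)

text \<open>The point with homogeneous coordinates \<open>x\<close>; only meaningful for \<open>x \<noteq> 0\<close>.\<close>

definition cp2_point :: "complex^3 \<Rightarrow> cp2" where
  "cp2_point x = abs_cp2 x"

lemma cp2_point_eq_iff:
  assumes "x \<noteq> 0" "y \<noteq> 0"
  shows "cp2_point x = cp2_point y \<longleftrightarrow> (\<exists>c. y = c *s x)"
proof -
  have refl: "proportional z z" if "z \<noteq> 0" for z
    using that by (auto simp: proportional_def intro!: exI[of _ 1])
  show ?thesis
    using Quotient3_rel[OF Quotient3_cp2, of x y] refl[OF assms(1)] refl[OF assms(2)] assms
    unfolding cp2_point_def proportional_def by auto
qed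

lemma cp2_point_cases: obtains x where "x \<noteq> 0" "p = cp2_point x"
proof -
  have "proportional (rep_cp2 p) (rep_cp2 p)"
    by (rule Quotient3_rep_reflp[OF Quotient3_cp2])
  then have "rep_cp2 p \<noteq> 0" by (simp add: proportional_def)
  moreover have "p = cp2_point (rep_cp2 p)"
    by (simp add: cp2_point_def Quotient3_abs_rep[OF Quotient3_cp2])
  ultimately show ?thesis by (rule that)
qed

text \<open>The quotient topology with respect to the projection of the (open) set of nonzero vectors.\<close>

instantiation cp2 :: topological_space
begin

definition open_cp2 :: "cp2 set \<Rightarrow> bool" where
  "open_cp2 U \<longleftrightarrow> open {x. x \<noteq> 0 \<and> cp2_point x \<in> U}"

instance
proof
  show "open (UNIV :: cp2 set)"
    by (simp add: open_cp2_def open_Collect_neq)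
next
  fix S T :: "cp2 set" assume "open S" "open T"
  moreover have "{x. x \<noteq> 0 \<and> cp2_point x \<in> S \<inter> T} =
      {x. x \<noteq> 0 \<and> cp2_point x \<in> S} \<inter> {x. x \<noteq> 0 \<and> cp2_point x \<in> T}" by auto
  ultimately show "open (S \<inter> T)" unfolding open_cp2_def by (simp add: open_Int)
next
  fix K :: "cp2 set set" assume "\<forall>S\<in>K. open S"
  moreover have "{x. x \<noteq> 0 \<and> cp2_point x \<in> \<Union>K} = (\<Union>S\<in>K. {x. x \<noteq> 0 \<and> cp2_point x \<in> S})"
    by auto
  ultimately show "open (\<Union>K)" unfolding open_cp2_def by (simp add: open_UN)
qed

end


section \<open>Plane curves and tangency\<close>

definition quadratic_form_over :: "complex set \<Rightarrow> (complex^3 \<Rightarrow> complex) \<Rightarrow> bool" where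
  "quadratic_form_over K q \<longleftrightarrow>
     (\<exists>A :: complex^3^3. (\<forall>i j. A $ i $ j \<in> K) \<and>
        q = (\<lambda>x. \<Sum>i\<in>UNIV. \<Sum>j\<in>UNIV. A $ i $ j * x $ i * x $ j))"

definition linear_form_over :: "complex set \<Rightarrow> (complex^3 \<Rightarrow> complex) \<Rightarrow> bool" where
  "linear_form_over K l \<longleftrightarrow>
     (\<exists>a :: complex^3. (\<forall>i. a $ i \<in> K) \<and> l = (\<lambda>x. \<Sum>i\<in>UNIV. a $ i * x $ i))"

definition gradient :: "(complex^3 \<Rightarrow> complex) \<Rightarrow> complex^3 \<Rightarrow> complex^3" where
  "gradient F x = (\<chi> i. deriv (\<lambda>t. F (x + t *s axis i 1)) 0)"

definition curve :: "(complex^3 \<Rightarrow> complex) \<Rightarrow> cp2 set" where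
  "curve F = {cp2_point x | x. x \<noteq> 0 \<and> F x = 0}"

definition smooth_curve :: "(complex^3 \<Rightarrow> complex) \<Rightarrow> bool" where
  "smooth_curve F \<longleftrightarrow> (\<forall>x. x \<noteq> 0 \<and> F x = 0 \<longrightarrow> gradient F x \<noteq> 0)"

text \<open>\<open>smooth_conic_over K q\<close> and \<open>line_over K l\<close>: \<open>q = 0\<close> and \<open>l = 0\<close> are equations, with
  coefficients in \<open>K\<close>, of a smooth conic and of a line. Smoothness concerns all complex points.\<close>

definition smooth_conic_over :: "complex set \<Rightarrow> (complex^3 \<Rightarrow> complex) \<Rightarrow> bool" where
  "smooth_conic_over K q \<longleftrightarrow> quadratic_form_over K q \<and> smooth_curve q"

definition line_over :: "complex set \<Rightarrow> (complex^3 \<Rightarrow> complex) \<Rightarrow> bool" where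
  "line_over K l \<longleftrightarrow> linear_form_over K l \<and> l \<noteq> (\<lambda>x. 0)"

text \<open>The projective tangent line of \<open>F = 0\<close> at a smooth point \<open>p\<close>. For homogeneous \<open>F\<close> the
  gradients at different homogeneous coordinates \<open>x\<close> of \<open>p\<close> are proportional, so the choice
  of \<open>x\<close> does not matter.\<close>

definition tangent_line :: "(complex^3 \<Rightarrow> complex) \<Rightarrow> cp2 \<Rightarrow> cp2 set" where
  "tangent_line F p =
     {cp2_point y | x y. x \<noteq> 0 \<and> y \<noteq> 0 \<and> cp2_point x = p \<and>
        (\<Sum>i\<in>UNIV. gradient F x $ i * y $ i) = 0}"

text \<open>Used for two conics as well as for a conic and a line (a line is its own tangent line).\<close>

definition tangent_at :: "(complex^3 \<Rightarrow> complex) \<Rightarrow> (complex^3 \<Rightarrow> complex) \<Rightarrow> cp2 \<Rightarrow> bool" where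
  "tangent_at F G p \<longleftrightarrow> p \<in> curve F \<and> p \<in> curve G \<and> tangent_line F p = tangent_line G p"

definition tangent :: "(complex^3 \<Rightarrow> complex) \<Rightarrow> (complex^3 \<Rightarrow> complex) \<Rightarrow> bool" where
  "tangent F G \<longleftrightarrow> (\<exists>p. tangent_at F G p)"

lemma gradient_quadratic_form:
  fixes A :: "complex^3^3"
  shows "gradient (\<lambda>x. \<Sum>i\<in>UNIV. \<Sum>j\<in>UNIV. A $ i $ j * x $ i * x $ j) x = (A + transpose A) *v x"
proof -
  have ax: "((\<lambda>t. x $ i + t * (axis k 1 :: complex^3) $ i) has_field_derivative axis k 1 $ i) (at 0)"
    for i k by (auto intro!: derivative_eq_intros)
  have "((\<lambda>t. \<Sum>i\<in>UNIV. \<Sum>j\<in>UNIV. A $ i $ j * (x + t *s axis k 1) $ i * (x + t *s axis k 1) $ j)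
      has_field_derivative
      (\<Sum>i\<in>UNIV. \<Sum>j\<in>UNIV. A $ i $ j * axis k 1 $ i * x $ j + A $ i $ j * x $ i * axis k 1 $ j)) (at 0)"
    for k
    by (simp only: vector_add_component vector_smult_component)
      (rule derivative_eq_intros ax refl | simp add: algebra_simps)+
  then have "gradient (\<lambda>x. \<Sum>i\<in>UNIV. \<Sum>j\<in>UNIV. A $ i $ j * x $ i * x $ j) x $ k =
      (\<Sum>i\<in>UNIV. \<Sum>j\<in>UNIV. A $ i $ j * axis k 1 $ i * x $ j + A $ i $ j * x $ i * axis k 1 $ j)" for k
    unfolding gradient_def by (simp add: DERIV_imp_deriv)
  moreover have "(\<Sum>i\<in>UNIV. \<Sum>j\<in>UNIV. A $ i $ j * axis k 1 $ i * x $ j + A $ i $ j * x $ i * axis k 1 $ j)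
      = ((A + transpose A) *v x) $ k" for k
    using exhaust_3[of k]
    by (auto simp: sum_3 matrix_vector_mult_def transpose_def axis_def algebra_simps)
  ultimately show ?thesis by (simp add: vec_eq_iff)
qed

lemma gradient_linear_form:
  fixes a :: "complex^3"
  shows "gradient (\<lambda>x. \<Sum>i\<in>UNIV. a $ i * x $ i) x = a"
proof -
  have "((\<lambda>t. \<Sum>i\<in>UNIV. a $ i * (x + t *s axis k 1) $ i) has_field_derivative
      (\<Sum>i\<in>UNIV. a $ i * axis k 1 $ i)) (at 0)" for k
    by (simp only: vector_add_component vector_smult_component)
      (auto intro!: derivative_eq_intros simp: mult.commute)
  then have "gradient (\<lambda>x. \<Sum>i\<in>UNIV. a $ i * x $ i) x $ k = (\<Sum>i\<in>UNIV. a $ i * axis k 1 $ i)" for k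
    unfolding gradient_def by (simp add: DERIV_imp_deriv)
  moreover have "(\<Sum>i\<in>UNIV. a $ i * axis k 1 $ i) = a $ k" for k
    using exhaust_3[of k] by (auto simp: sum_3 axis_def)
  ultimately show ?thesis by (simp add: vec_eq_iff)
qed

lemma tangent_line_linear_form:
  assumes "linear_form_over K l"
  shows "tangent_line l p = curve l"
proof -
  obtain a where l: "l = (\<lambda>x. \<Sum>i\<in>UNIV. a $ i * x $ i)"
    using assms by (auto simp: linear_form_over_def)
  obtain z where "z \<noteq> 0" "p = cp2_point z" by (rule cp2_point_cases)
  then show ?thesis
    unfolding tangent_line_def curve_def l gradient_linear_form by auto
qed


section \<open>The fundamental group\<close>

definition loops :: "'a::topological_space set \<Rightarrow> 'a \<Rightarrow> (real \<Rightarrow> 'a) set" where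
  "loops X b = {p. path p \<and> path_image p \<subseteq> X \<and> pathstart p = b \<and> pathfinish p = b}"

definition loop_homotopy :: "'a::topological_space set \<Rightarrow> 'a \<Rightarrow> ((real \<Rightarrow> 'a) \<times> (real \<Rightarrow> 'a)) set" where
  "loop_homotopy X b = {(p, q). p \<in> loops X b \<and> q \<in> loops X b \<and> homotopic_paths X p q}"

definition fundamental_group :: "'a::topological_space set \<Rightarrow> 'a \<Rightarrow> (real \<Rightarrow> 'a) set monoid" where
  "fundamental_group X b =
     \<lparr>carrier = loops X b // loop_homotopy X b,
      monoid.mult = (\<lambda>P Q. \<Union>p\<in>P. \<Union>q\<in>Q. loop_homotopy X b `` {p +++ q}),
      one = loop_homotopy X b `` {\<lambda>_. b}\<rparr>"


lemma equiv_loop_homotopy: "equiv (loops X b) (loop_homotopy X b)"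
proof (rule equivI)
  show "refl_on (loops X b) (loop_homotopy X b)"
    by (auto simp: refl_on_def loop_homotopy_def loops_def)
  show "sym (loop_homotopy X b)"
    by (auto simp: sym_def loop_homotopy_def intro: homotopic_paths_sym)
  show "trans (loop_homotopy X b)"
    by (auto simp: trans_def loop_homotopy_def intro: homotopic_paths_trans)
  show "loop_homotopy X b \<subseteq> loops X b \<times> loops X b"
    by (auto simp: loop_homotopy_def)
qed

lemma loops_join: "p \<in> loops X b \<Longrightarrow> q \<in> loops X b \<Longrightarrow> p +++ q \<in> loops X b"
  by (auto simp: loops_def path_image_join)

lemma fundamental_group_mult:
  assumes "p \<in> loops X b" "q \<in> loops X b"
  shows "loop_homotopy X b `` {p} \<otimes>\<^bsub>fundamental_group X b\<^esub> loop_homotopy X b `` {q} =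
    loop_homotopy X b `` {p +++ q}"
proof -
  let ?R = "loop_homotopy X b"
  have eq: "?R `` {p' +++ q'} = ?R `` {p +++ q}" if "(p, p') \<in> ?R" "(q, q') \<in> ?R" for p' q'
  proof -
    have "homotopic_paths X (p +++ q) (p' +++ q')"
      using that assms by (intro homotopic_paths_join) (simp_all add: loop_homotopy_def loops_def)
    then have "(p +++ q, p' +++ q') \<in> ?R"
      using that by (simp add: loop_homotopy_def loops_join)
    then show ?thesis using equiv_class_eq[OF equiv_loop_homotopy] by metis
  qed
  have "(p, p) \<in> ?R" "(q, q) \<in> ?R"
    using assms equiv_loop_homotopy[of X b] by (auto simp: equiv_def refl_on_def)
  then have ne: "?R `` {p} \<noteq> {}" "?R `` {q} \<noteq> {}" by blast+
  have "(\<Union>p'\<in>?R `` {p}. \<Union>q'\<in>?R `` {q}. ?R `` {p' +++ q'}) =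
      (\<Union>p'\<in>?R `` {p}. \<Union>q'\<in>?R `` {q}. ?R `` {p +++ q})"
    by (intro SUP_cong refl eq) simp_all
  then show ?thesis using ne by (simp add: fundamental_group_def)
qed

lemma loop_rid:
  assumes "p \<in> loops X b"
  shows "homotopic_paths X (p +++ (\<lambda>_. b)) p"
proof -
  have f: "continuous_on {0..1} (\<lambda>t::real. min (2 * t) 1)"
    by (intro continuous_intros)
  have "homotopic_paths X p (p +++ (\<lambda>_. b))"
    by (rule homotopic_paths_reparametrize[where f = "\<lambda>t. min (2 * t) 1"])
      (use assms f in \<open>auto simp: loops_def joinpaths_def pathfinish_def min_def\<close>)
  then show ?thesis by (rule homotopic_paths_sym)
qed

lemma loop_lid:
  assumes "p \<in> loops X b"
  shows "homotopic_paths X ((\<lambda>_. b) +++ p) p"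
proof -
  have f: "continuous_on {0..1} (\<lambda>t::real. max (2 * t - 1) 0)"
    by (intro continuous_intros)
  have "homotopic_paths X p ((\<lambda>_. b) +++ p)"
    by (rule homotopic_paths_reparametrize[where f = "\<lambda>t. max (2 * t - 1) 0"])
      (use assms f in \<open>auto simp: loops_def joinpaths_def pathstart_def max_def\<close>)
  then show ?thesis by (rule homotopic_paths_sym)
qed

lemma loop_linv:
  assumes "p \<in> loops X b"
  shows "homotopic_paths X (reversepath p +++ p) (\<lambda>_. b)"
proof -
  define h where "h = (\<lambda>y::real\<times>real. 1 - fst y * (1 - \<bar>2 * snd y - 1\<bar>))"
  have p: "continuous_on {0..1} p" "p ` {0..1} \<subseteq> X" "p 0 = b" "p 1 = b"
    using assms by (auto simp: loops_def path_def path_image_def pathstart_def pathfinish_def)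
  have h01: "h y \<in> {0..1}" if "y \<in> {0..1} \<times> {0..1}" for y
  proof -
    have "0 \<le> 1 - \<bar>2 * snd y - 1\<bar>" "1 - \<bar>2 * snd y - 1\<bar> \<le> 1" "0 \<le> fst y" "fst y \<le> 1"
      using that by auto
    then show ?thesis
      using mult_le_one[of "fst y" "1 - \<bar>2 * snd y - 1\<bar>"] by (simp add: h_def)
  qed
  have "continuous_on ({0..1} \<times> {0..1}) h"
    unfolding h_def by (intro continuous_intros)
  moreover have "h ` ({0..1} \<times> {0..1}) \<subseteq> {0..1}" using h01 by blast
  ultimately have cont: "continuous_on ({0..1} \<times> {0..1}) (p \<circ> h)"
    using continuous_on_compose continuous_on_subset[OF p(1)] by blast
  have "(p \<circ> h) ` ({0..1} \<times> {0..1}) \<subseteq> X" using h01 p(2) by auto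
  moreover have "(p \<circ> h) (0, x) = b" for x using p by (simp add: h_def)
  moreover have "(p \<circ> h) (1, x) = (reversepath p +++ p) x" for x
    by (cases "x \<le> 1/2") (simp_all add: h_def joinpaths_def reversepath_def)
  moreover have "(p \<circ> h) (t, 0) = b" "(p \<circ> h) (t, 1) = b" for t
    using p by (auto simp: h_def)
  ultimately have "homotopic_paths X (\<lambda>_. b) (reversepath p +++ p)"
    unfolding homotopic_paths using cont
    by (intro exI[of _ "p \<circ> h"]) (auto simp: pathstart_def pathfinish_def Pi_iff image_subset_iff)
  then show ?thesis by (rule homotopic_paths_sym)
qed

theorem group_fundamental_group:
  assumes "b \<in> X"
  shows "group (fundamental_group X b)"
proof -
  let ?R = "loop_homotopy X b" and ?G = "fundamental_group X b"
  have carrier: "carrier ?G = (\<lambda>p. ?R `` {p}) ` loops X b"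
    by (auto simp: fundamental_group_def quotient_def)
  have one: "\<one>\<^bsub>?G\<^esub> = ?R `` {\<lambda>_. b}"
    by (simp add: fundamental_group_def)
  have const: "(\<lambda>_. b) \<in> loops X b"
    using assms by (auto simp: loops_def path_def path_image_def pathstart_def pathfinish_def)
  have eq: "?R `` {p} = ?R `` {q}" if "p \<in> loops X b" "q \<in> loops X b" "homotopic_paths X p q" for p q
    using that by (intro equiv_class_eq[OF equiv_loop_homotopy]) (simp add: loop_homotopy_def)
  show ?thesis
  proof (rule groupI)
    fix P Q assume "P \<in> carrier ?G" "Q \<in> carrier ?G"
    then show "P \<otimes>\<^bsub>?G\<^esub> Q \<in> carrier ?G"
      unfolding carrier by (auto simp: fundamental_group_mult intro: loops_join)
  next
    show "\<one>\<^bsub>?G\<^esub> \<in> carrier ?G" unfolding carrier one using const by blast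
  next
    fix P Q R assume "P \<in> carrier ?G" "Q \<in> carrier ?G" "R \<in> carrier ?G"
    then obtain p q r where pqr: "p \<in> loops X b" "q \<in> loops X b" "r \<in> loops X b"
      "P = ?R `` {p}" "Q = ?R `` {q}" "R = ?R `` {r}"
      unfolding carrier by blast
    have "homotopic_paths X ((p +++ q) +++ r) (p +++ (q +++ r))"
      using pqr(1-3) by (intro homotopic_paths_sym[OF homotopic_paths_assoc]) (auto simp: loops_def)
    then have "?R `` {(p +++ q) +++ r} = ?R `` {p +++ (q +++ r)}"
      by (intro eq loops_join pqr(1-3))
    then show "P \<otimes>\<^bsub>?G\<^esub> Q \<otimes>\<^bsub>?G\<^esub> R = P \<otimes>\<^bsub>?G\<^esub> (Q \<otimes>\<^bsub>?G\<^esub> R)"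
      using pqr by (simp add: fundamental_group_mult loops_join)
  next
    fix P assume "P \<in> carrier ?G"
    then obtain p where p: "p \<in> loops X b" "P = ?R `` {p}" unfolding carrier by blast
    show "\<one>\<^bsub>?G\<^esub> \<otimes>\<^bsub>?G\<^esub> P = P"
      unfolding one p(2) using p(1) const
      by (simp add: fundamental_group_mult eq loops_join loop_lid)
    have rev: "reversepath p \<in> loops X b" using p(1) by (auto simp: loops_def)
    have "?R `` {reversepath p} \<otimes>\<^bsub>?G\<^esub> P = \<one>\<^bsub>?G\<^esub>"
      unfolding one p(2) using p(1) const rev
      by (simp add: fundamental_group_mult eq loops_join loop_linv)
    then show "\<exists>Q\<in>carrier ?G. Q \<otimes>\<^bsub>?G\<^esub> P = \<one>\<^bsub>?G\<^esub>"
      unfolding carrier using rev by blast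
  qed
qed


section \<open>Free groups and big groups\<close>

text \<open>Words in the letters \<open>(True, x)\<close> and \<open>(False, x)\<close>, standing for \<open>x\<close> and \<open>x\<inverse>\<close>.\<close>

definition free_words :: "'a set \<Rightarrow> (bool \<times> 'a) list set" where
  "free_words S = lists (UNIV \<times> S)"

definition free_cancel :: "'a set \<Rightarrow> ((bool \<times> 'a) list \<times> (bool \<times> 'a) list) set" where
  "free_cancel S = {(u @ [(e, x), (\<not> e, x)] @ v, u @ v) | u e x v.
     u \<in> free_words S \<and> v \<in> free_words S \<and> x \<in> S}"

definition free_equiv :: "'a set \<Rightarrow> ((bool \<times> 'a) list \<times> (bool \<times> 'a) list) set" where
  "free_equiv S = Restr ((free_cancel S \<union> (free_cancel S)\<inverse>)\<^sup>*) (free_words S)"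

definition free_group :: "'a set \<Rightarrow> (bool \<times> 'a) list set monoid" where
  "free_group S =
     \<lparr>carrier = free_words S // free_equiv S,
      monoid.mult = (\<lambda>U V. \<Union>u\<in>U. \<Union>v\<in>V. free_equiv S `` {u @ v}),
      one = free_equiv S `` {[]}\<rparr>"

lemma equiv_free_equiv: "equiv (free_words S) (free_equiv S)"
proof -
  let ?C = "free_cancel S \<union> (free_cancel S)\<inverse>"
  have s: "sym (?C\<^sup>*)" by (rule sym_rtrancl[OF sym_Un_converse])
  have t: "trans (?C\<^sup>*)" by (rule trans_rtrancl)
  show ?thesis
    unfolding free_equiv_def
  proof (rule equivI)
    show "refl_on (free_words S) (Restr (?C\<^sup>*) (free_words S))"
      by (simp add: refl_on_def)
    show "sym (Restr (?C\<^sup>*) (free_words S))"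
      using symD[OF s] by (intro symI) blast
    show "trans (Restr (?C\<^sup>*) (free_words S))"
      by (rule trans_Restr[OF t])
  qed simp
qed

lemma free_words_append [simp]:
  "u @ v \<in> free_words S \<longleftrightarrow> u \<in> free_words S \<and> v \<in> free_words S"
  by (simp add: free_words_def)

lemma free_equiv_append:
  assumes "(u, u') \<in> free_equiv S" "(v, v') \<in> free_equiv S"
  shows "(u @ v, u' @ v') \<in> free_equiv S"
proof -
  let ?C = "free_cancel S \<union> (free_cancel S)\<inverse>"
  have W: "u \<in> free_words S" "u' \<in> free_words S" "v \<in> free_words S" "v' \<in> free_words S"
    using assms by (auto simp: free_equiv_def)
  have cancel: "(w @ s @ w', w @ t @ w') \<in> free_cancel S"
    if st: "(s, t) \<in> free_cancel S" and w: "w \<in> free_words S" "w' \<in> free_words S" for s t w w'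
  proof -
    obtain y e x z where "s = y @ [(e, x), (\<not> e, x)] @ z" "t = y @ z"
      "y \<in> free_words S" "z \<in> free_words S" "x \<in> S"
      using st unfolding free_cancel_def by blast
    then have "w @ s @ w' = (w @ y) @ [(e, x), (\<not> e, x)] @ (z @ w')" "w @ t @ w' = (w @ y) @ (z @ w')"
      "w @ y \<in> free_words S" "z @ w' \<in> free_words S" "x \<in> S"
      using w by auto
    then show ?thesis unfolding free_cancel_def by blast
  qed
  have ctxt: "(w @ s @ w', w @ t @ w') \<in> ?C\<^sup>*"
    if "(s, t) \<in> ?C\<^sup>*" and w: "w \<in> free_words S" "w' \<in> free_words S" for s t w w'
    using that(1)
  proof induction
    case (step y z)
    then have "(w @ y @ w', w @ z @ w') \<in> ?C" using cancel w by blast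
    then show ?case using step.IH by (rule rtrancl_into_rtrancl[rotated])
  qed simp
  have nil: "[] \<in> free_words S" by (simp add: free_words_def)
  have "(u @ v, u' @ v) \<in> ?C\<^sup>*" "(u' @ v, u' @ v') \<in> ?C\<^sup>*"
    using ctxt[of u u' "[]" v] ctxt[of v v' u' "[]"] assms nil W by (auto simp: free_equiv_def)
  then have "(u @ v, u' @ v') \<in> ?C\<^sup>*" by (rule rtrancl_trans)
  then show ?thesis using W by (simp add: free_equiv_def)
qed

lemma free_group_mult:
  assumes "u \<in> free_words S" "v \<in> free_words S"
  shows "free_equiv S `` {u} \<otimes>\<^bsub>free_group S\<^esub> free_equiv S `` {v} = free_equiv S `` {u @ v}"
proof -
  let ?R = "free_equiv S"
  have eq: "?R `` {u' @ v'} = ?R `` {u @ v}" if "(u, u') \<in> ?R" "(v, v') \<in> ?R" for u' v'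
    using equiv_class_eq[OF equiv_free_equiv free_equiv_append[OF that]] by simp
  have "(u, u) \<in> ?R" "(v, v) \<in> ?R"
    using assms by (auto simp: free_equiv_def)
  then have ne: "?R `` {u} \<noteq> {}" "?R `` {v} \<noteq> {}" by blast+
  have "(\<Union>u'\<in>?R `` {u}. \<Union>v'\<in>?R `` {v}. ?R `` {u' @ v'}) =
      (\<Union>u'\<in>?R `` {u}. \<Union>v'\<in>?R `` {v}. ?R `` {u @ v})"
    by (intro SUP_cong refl eq) simp_all
  then show ?thesis using ne by (simp add: free_group_def)
qed

lemma free_word_inverse:
  "u \<in> free_words S \<Longrightarrow> \<exists>v\<in>free_words S. (v @ u, []) \<in> free_equiv S"
proof (induction u)
  case Nil
  then show ?case by (auto simp: free_equiv_def)
next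
  case (Cons a u)
  obtain e x where a: "a = (e, x)" by (cases a)
  have x: "x \<in> S" "u \<in> free_words S" using Cons.prems by (auto simp: free_words_def a)
  then obtain v where v: "v \<in> free_words S" "(v @ u, []) \<in> free_equiv S" using Cons.IH by blast
  have letter: "[(\<not> e, x)] \<in> free_words S" using x by (simp add: free_words_def)
  have "(v @ [(\<not> e, x), (\<not> \<not> e, x)] @ u, v @ u) \<in> free_cancel S"
    unfolding free_cancel_def using v x by blast
  then have "((v @ [(\<not> e, x)]) @ a # u, v @ u) \<in> free_equiv S"
    using v(1) x letter Cons.prems by (auto simp: free_equiv_def a free_words_def)
  then have "((v @ [(\<not> e, x)]) @ a # u, []) \<in> free_equiv S"
    using v(2) equiv_free_equiv[of S] by (meson equivE transD)
  then show ?case using v(1) letter by (metis free_words_append)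
qed

theorem group_free_group: "group (free_group S)"
proof -
  let ?R = "free_equiv S" and ?G = "free_group S"
  have carrier: "carrier ?G = (\<lambda>u. ?R `` {u}) ` free_words S"
    by (auto simp: free_group_def quotient_def)
  have one: "\<one>\<^bsub>?G\<^esub> = ?R `` {[]}" by (simp add: free_group_def)
  have nil: "[] \<in> free_words S" by (simp add: free_words_def)
  show ?thesis
  proof (rule groupI)
    fix U assume "U \<in> carrier ?G"
    then obtain u where u: "u \<in> free_words S" "U = ?R `` {u}" unfolding carrier by blast
    obtain v where v: "v \<in> free_words S" "(v @ u, []) \<in> ?R" using free_word_inverse[OF u(1)] by blast
    have "?R `` {v} \<otimes>\<^bsub>?G\<^esub> U = \<one>\<^bsub>?G\<^esub>"
      unfolding u(2) free_group_mult[OF v(1) u(1)] one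
      by (rule equiv_class_eq[OF equiv_free_equiv v(2)])
    then show "\<exists>V\<in>carrier ?G. V \<otimes>\<^bsub>?G\<^esub> U = \<one>\<^bsub>?G\<^esub>" unfolding carrier using v(1) by blast
  qed (auto simp: carrier one nil free_group_mult)
qed

text \<open>A basis of a subgroup \<open>H\<close> is a subset of \<open>H\<close>, so it is no restriction to take the
  free generators from the element type of the group.\<close>

definition big_group :: "('a, 'b) monoid_scheme \<Rightarrow> bool" where
  "big_group G \<longleftrightarrow>
     (\<exists>H (S :: 'a set). subgroup H G \<and> (\<exists>a\<in>S. \<exists>b\<in>S. a \<noteq> b) \<and>
        free_group S \<cong> G\<lparr>carrier := H\<rparr>)"

end

theory Submission
  imports Defs "HOL-Algebra.Coset"
begin

text \<open>After rescaling, the two conics are \<open>Q = 0\<close> and \<open>Q + Z\<^sup>2 = 0\<close>, where \<open>Z\<close> is an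
  equation of the line through the two tangency points. On the double cover \<open>Q = 1\<close> of the complement
  of the conics the function \<open>Z\<close> avoids \<open>\<plusminus>\<i>\<close>, and the deck transformation changes its sign; so the complement
  maps onto the orbifold \<open>(\<complex> - {\<i>, - \<i>}) / \<plusminus>\<close>, whose group is the free product of \<open>\<int>\<close> and
  \<open>\<int>/2\<close>. This is used through a local system with fibre \<open>\<int>\<^sup>2\<close> in which crossing the slit above \<open>\<i>\<close>
  acts by a shear and the deck transformation by exchanging the coordinates. A line through a
  tangency point carries loops with monodromies the two transposed shears, which generate a free
  group by ping-pong. When that line tends to the line through both tangency points, these loops shrink to the
  other tangency point in the direction of the common tangent there, so they leave every line except
  this tangent, which is excluded by assumption.\<close>

section \<open>Ping-pong\<close>

text \<open>Bigness asks only for two elements that play ping-pong in some action, so a linear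
  action on \<open>int \<times> int\<close> replaces a presentation of the group. The local system
  lives on the complement of the two conics; the lines constrain only the loops, which must stay in
  \<open>- T\<close>. A line through a tangency point, other than \<open>Z = 0\<close> itself, meets
  \<open>Z = 0\<close> only in that point, so on it \<open>Z\<close> omits \<open>0\<close> away
  from the conics. The loops therefore run in the annulus between the radii 1/2 and 2. They are
  assembled from two half-loops from \<open>1\<close> to \<open>- 1\<close>: one passes above
  \<open>\<i>\<close>, the other between \<open>- \<i>\<close> and \<open>\<i>\<close>. As
  \<open>s\<close> and \<open>- s\<close> give the same point, both halves are closed in the plane.
  Their monodromies are a shear followed by the exchange of coordinates, and the exchange alone;
  composing them in the two orders gives the two shears, up to conjugation by the sheet convention.
  No global lift to the double cover is continuous, so lifts are chosen arbitrarily and the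
  transition maps correct the choice.\<close>

primrec word_eval :: "('a, 'b) monoid_scheme \<Rightarrow> (bool \<times> 'a) list \<Rightarrow> 'a" where
  "word_eval G [] = \<one>\<^bsub>G\<^esub>"
| "word_eval G (l # w) = (if fst l then snd l else inv\<^bsub>G\<^esub> (snd l)) \<otimes>\<^bsub>G\<^esub> word_eval G w"

definition reduced :: "(bool \<times> 'a) list \<Rightarrow> bool" where
  "reduced = successively (\<lambda>k l. l \<noteq> (\<not> fst k, snd k))"

lemma free_equiv_refl: "u \<in> free_words S \<Longrightarrow> (u, u) \<in> free_equiv S"
  by (simp add: free_equiv_def)

lemma free_equiv_trans:
  "(u, v) \<in> free_equiv S \<Longrightarrow> (v, w) \<in> free_equiv S \<Longrightarrow> (u, w) \<in> free_equiv S"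
  using equiv_free_equiv[of S] by (meson equivE transD)

lemma free_words_Cons [simp]: "l # w \<in> free_words S \<longleftrightarrow> snd l \<in> S \<and> w \<in> free_words S"
  by (cases l) (auto simp: free_words_def)

lemma free_words_Nil [simp]: "[] \<in> free_words S"
  by (simp add: free_words_def)

lemma free_equiv_Cons:
  assumes "(u, v) \<in> free_equiv S" "snd l \<in> S"
  shows "(l # u, l # v) \<in> free_equiv S"
  using free_equiv_append[OF free_equiv_refl[of "[l]"] assms(1)] assms(2) by simp

lemma free_equiv_cancel:
  assumes "snd l \<in> S" "w \<in> free_words S"
  shows "(l # (\<not> fst l, snd l) # w, w) \<in> free_equiv S"
proof -
  have "([] @ [(fst l, snd l), (\<not> fst l, snd l)] @ w, [] @ w) \<in> free_cancel S"
    unfolding free_cancel_def using assms free_words_Nil by blast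
  then have "(l # (\<not> fst l, snd l) # w, w) \<in> (free_cancel S \<union> (free_cancel S)\<inverse>)\<^sup>*"
    by (intro r_into_rtrancl) simp
  then show ?thesis using assms by (simp add: free_equiv_def)
qed

text \<open>Only existence of a reduced form is claimed; that nonempty reduced words are nontrivial
  comes from ping-pong.\<close>

lemma ex_reduced_word:
  "u \<in> free_words S \<Longrightarrow> \<exists>w \<in> free_words S. reduced w \<and> (u, w) \<in> free_equiv S"
proof (induction u)
  case Nil
  then show ?case using free_equiv_refl[of "[]" S] by (intro bexI[of _ "[]"]) (auto simp: reduced_def)
next
  case (Cons l u)
  then obtain w where w: "w \<in> free_words S" "reduced w" "(u, w) \<in> free_equiv S" by auto
  have lw: "(l # u, l # w) \<in> free_equiv S" using free_equiv_Cons[OF w(3)] Cons.prems by simp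
  show ?case
  proof (cases "\<exists>w'. w = (\<not> fst l, snd l) # w'")
    case True
    then obtain w' where w': "w = (\<not> fst l, snd l) # w'" by blast
    have "(l # u, w') \<in> free_equiv S"
      using free_equiv_trans[OF lw] free_equiv_cancel[of l S w'] w w' Cons.prems by simp
    moreover have "reduced w'" using w(2) w' by (auto simp: reduced_def successively_Cons)
    ultimately show ?thesis using w w' by auto
  next
    case False
    then have "reduced (l # w)" using w(2) by (cases w) (auto simp: reduced_def successively_Cons)
    then show ?thesis using lw w Cons.prems by auto
  qed
qed

section \<open>Homomorphisms from a free group and the ping-pong criterion\<close>

context group
begin

lemma word_eval_closed [simp]:
  "S \<subseteq> carrier G \<Longrightarrow> w \<in> free_words S \<Longrightarrow> word_eval G w \<in> carrier G"
  by (induction w) auto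

lemma word_eval_append:
  assumes S: "S \<subseteq> carrier G"
  shows "u \<in> free_words S \<Longrightarrow> v \<in> free_words S \<Longrightarrow> word_eval G (u @ v) = word_eval G u \<otimes> word_eval G v"
proof (induction u)
  case (Cons l u)
  then have "snd l \<in> carrier G" using S by auto
  then show ?case using Cons S by (simp add: m_assoc)
qed (use S in simp)

lemma word_eval_free_equiv:
  assumes S: "S \<subseteq> carrier G" and uv: "(u, v) \<in> free_equiv S"
  shows "word_eval G u = word_eval G v"
proof -
  have cancel: "word_eval G s = word_eval G t" if st: "(s, t) \<in> free_cancel S" for s t
  proof -
    obtain y e x z where eq: "s = y @ [(e, x), (\<not> e, x)] @ z" "t = y @ z"
      and mem: "y \<in> free_words S" "z \<in> free_words S" "x \<in> S"
      using st unfolding free_cancel_def by blast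
    have x: "x \<in> carrier G" using mem S by auto
    have "word_eval G ([(e, x), (\<not> e, x)] @ z) = word_eval G z"
      using x mem S by (auto simp: m_assoc[symmetric])
    then show ?thesis unfolding eq using mem S by (simp add: word_eval_append del: append.simps)
  qed
  have "(u, v) \<in> (free_cancel S \<union> (free_cancel S)\<inverse>)\<^sup>*"
    using uv by (simp add: free_equiv_def)
  then show ?thesis
  proof induction
    case (step y z)
    then show ?case using cancel by auto
  qed simp
qed

text \<open>The action \<open>\<phi>\<close> is a right action because the concatenation of loops composes
  transports in the reverse order.\<close>

lemma big_group_ping_pong:
  fixes \<phi> :: "'a \<Rightarrow> 'm \<Rightarrow> 'm" and W :: "bool \<times> 'a \<Rightarrow> 'm set"
  assumes S: "S \<subseteq> carrier G" "x \<in> S" "y \<in> S" "x \<noteq> y"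
    and one: "\<phi> \<one> = id"
    and mult: "\<And>g h. g \<in> carrier G \<Longrightarrow> h \<in> carrier G \<Longrightarrow> \<phi> (g \<otimes> h) = \<phi> h \<circ> \<phi> g"
    and W: "\<And>l. snd l \<in> S \<Longrightarrow> m\<^sub>0 \<notin> W l"
    and ping: "\<And>l. snd l \<in> S \<Longrightarrow> \<phi> (if fst l then snd l else inv snd l) m\<^sub>0 \<in> W l"
    and pong: "\<And>k l m. snd k \<in> S \<Longrightarrow> snd l \<in> S \<Longrightarrow> l \<noteq> (\<not> fst k, snd k) \<Longrightarrow> m \<in> W k \<Longrightarrow>
      \<phi> (if fst l then snd l else inv snd l) m \<in> W l"
  shows "big_group G"
proof -
  have carrier: "carrier (free_group S) = (\<lambda>u. free_equiv S `` {u}) ` free_words S"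
    by (auto simp: free_group_def quotient_def)
  define \<Phi> where "\<Phi> U = word_eval G (SOME u. u \<in> U)" for U
  have \<Phi>: "\<Phi> (free_equiv S `` {u}) = word_eval G u" if "u \<in> free_words S" for u
  proof -
    have "u \<in> free_equiv S `` {u}" using free_equiv_refl that by auto
    then have "(SOME v. v \<in> free_equiv S `` {u}) \<in> free_equiv S `` {u}" by (rule someI)
    then show ?thesis unfolding \<Phi>_def using word_eval_free_equiv[OF S(1)] by force
  qed
  have hom: "\<Phi> \<in> hom (free_group S) G"
    by (rule homI) (use S(1) in \<open>auto simp: carrier \<Phi> free_group_mult word_eval_append[OF S(1)]\<close>)
  interpret \<Phi>: group_hom "free_group S" G \<Phi>
    using hom group_free_group by (simp add: group_hom_def group_hom_axioms_def is_group)
  \<comment> \<open>As \<open>\<phi>\<close> is a right action, the first letter acts first. The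
    last premise records where the point may be before that letter, and the last letter decides
    where the point ends.\<close>
  have orbit: "\<phi> (word_eval G w) m \<in> W (last w)"
    if "w \<noteq> []" "reduced w" "w \<in> free_words S" "m = m\<^sub>0 \<or> (\<exists>k. snd k \<in> S \<and> hd w \<noteq> (\<not> fst k, snd k) \<and> m \<in> W k)"
    for w m
    using that
  proof (induction w arbitrary: m)
    case (Cons l w)
    let ?g = "if fst l then snd l else inv snd l"
    have l: "snd l \<in> S" and w: "w \<in> free_words S" using Cons.prems by auto
    then have g: "?g \<in> carrier G" using S by auto
    have m: "\<phi> ?g m \<in> W l" using Cons.prems(4) ping[OF l] pong[OF _ l] by auto
    have *: "\<phi> (word_eval G (l # w)) m = \<phi> (word_eval G w) (\<phi> ?g m)"
      using mult[OF g word_eval_closed[OF S(1) w]] by simp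
    show ?case
    proof (cases "w = []")
      case True
      then show ?thesis using * m one by simp
    next
      case False
      then have "reduced w" "hd w \<noteq> (\<not> fst l, snd l)"
        using Cons.prems(2) by (auto simp: reduced_def successively_Cons)
      then have "\<phi> (word_eval G w) (\<phi> ?g m) \<in> W (last w)"
        using m l by (intro Cons.IH False w disjI2 exI[of _ l]) auto
      then show ?thesis using * False by simp
    qed
  qed simp
  have ker: "U = \<one>\<^bsub>free_group S\<^esub>" if U: "U \<in> carrier (free_group S)" and eq: "\<Phi> U = \<one>" for U
  proof -
    obtain u where u: "u \<in> free_words S" "U = free_equiv S `` {u}" using U unfolding carrier by blast
    obtain w where w: "w \<in> free_words S" "reduced w" "(u, w) \<in> free_equiv S"
      using ex_reduced_word[OF u(1)] by blast
    have "word_eval G w = \<one>" using word_eval_free_equiv[OF S(1) w(3)] eq u \<Phi> by simp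
    have "w = []"
    proof (rule ccontr)
      assume "w \<noteq> []"
      then have "snd (last w) \<in> S"
        using w(1) last_in_set[of w] unfolding free_words_def in_lists_conv_set
        by (metis mem_Sigma_iff prod.collapse)
      moreover have "\<phi> (word_eval G w) m\<^sub>0 \<in> W (last w)"
        using orbit[OF \<open>w \<noteq> []\<close> w(2,1)] by blast
      ultimately show False using W \<open>word_eval G w = \<one>\<close> one by simp
    qed
    then show ?thesis
      using w(3) u(2) equiv_class_eq[OF equiv_free_equiv] by (force simp: free_group_def)
  qed
  have inj: "inj_on \<Phi> (carrier (free_group S))"
    using ker by (simp add: \<Phi>.inj_on_one_iff)
  let ?H = "\<Phi> ` carrier (free_group S)"
  have "subgroup ?H G" by (rule \<Phi>.img_is_subgroup)
  moreover have "\<Phi> \<in> iso (free_group S) (G\<lparr>carrier := ?H\<rparr>)"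
    using hom inj by (auto simp: iso_def hom_def bij_betw_def)
  ultimately show ?thesis unfolding big_group_def is_iso_def using S by blast
qed

end

text \<open>The power \<open>k\<close> of the matrix with rows (1, 3) and (0, 1). The factor 3
  admits the base point (1, 1) of the ping-pong: 1 - 3 exceeds 1 in absolute value, whereas 1 - 2
  does not.\<close>

definition shear :: "int \<Rightarrow> int \<times> int \<Rightarrow> int \<times> int" where
  "shear k = (\<lambda>(m, n). (m + 3 * k * n, n))"

lemma shear_0 [simp]: "shear 0 = id"
  by (auto simp: shear_def)

lemma shear_comp_shear: "shear k \<circ> shear l = shear (k + l)"
  by (auto simp: shear_def fun_eq_iff algebra_simps)

lemma swap_comp_swap: "prod.swap \<circ> prod.swap = id"
  by auto

text \<open>The disjuncts are the places from which the letter may be played: the cone reached by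
  the same letter, the cones of the other generator, and the base point on the diagonal.\<close>

lemma abs_add_mult_3:
  fixes m n :: int
  assumes "m * n > 0 \<or> \<bar>m\<bar> < \<bar>n\<bar> \<or> (m = n \<and> n \<noteq> 0)"
  shows "\<bar>n\<bar> < \<bar>m + 3 * n\<bar> \<and> (m + 3 * n) * n > 0"
proof -
  have "(m > 0 \<and> n > 0) \<or> (m < 0 \<and> n < 0) \<or> \<bar>m\<bar> < \<bar>n\<bar> \<or> (m = n \<and> n \<noteq> 0)"
    using assms by (auto simp: zero_less_mult_iff)
  then show ?thesis by (auto simp: zero_less_mult_iff)
qed

lemma abs_diff_mult_3:
  fixes m n :: int
  assumes "m * n < 0 \<or> \<bar>m\<bar> < \<bar>n\<bar> \<or> (m = n \<and> n \<noteq> 0)"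
  shows "\<bar>n\<bar> < \<bar>m - 3 * n\<bar> \<and> (m - 3 * n) * n < 0"
proof -
  have "(m > 0 \<and> n < 0) \<or> (m < 0 \<and> n > 0) \<or> \<bar>m\<bar> < \<bar>n\<bar> \<or> (m = n \<and> n \<noteq> 0)"
    using assms by (auto simp: mult_less_0_iff)
  then show ?thesis by (auto simp: mult_less_0_iff)
qed

lemma (in group) big_group_shears:
  assumes xy: "x \<in> carrier G" "y \<in> carrier G"
    and one: "\<phi> \<one> = id"
    and mult: "\<And>g h. g \<in> carrier G \<Longrightarrow> h \<in> carrier G \<Longrightarrow> \<phi> (g \<otimes> h) = \<phi> h \<circ> \<phi> g"
    and x: "\<phi> x = shear 1" and y: "\<phi> y = prod.swap \<circ> shear 1 \<circ> prod.swap"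
  shows "big_group G"
proof -
  have inv: "\<phi> (inv g) = f" if g: "g \<in> carrier G" and f: "\<phi> g \<circ> f = id" for g f
  proof -
    have "\<phi> (inv g) \<circ> \<phi> g = id" using mult[of g "inv g"] one g by simp
    then have "\<phi> (inv g) \<circ> (\<phi> g \<circ> f) = f" by (simp add: o_assoc)
    then show ?thesis using f by simp
  qed
  have inv_x: "\<phi> (inv x) = shear (- 1)"
    using x by (intro inv xy) (simp add: shear_comp_shear)
  have inv_y: "\<phi> (inv y) = prod.swap \<circ> shear (- 1) \<circ> prod.swap"
    by (intro inv xy) (auto simp: y shear_def fun_eq_iff)
  have "\<phi> x (0, 1) \<noteq> \<phi> y (0, 1)" unfolding x y by (simp add: shear_def)
  then have neq: "x \<noteq> y" by auto
  \<comment> \<open>The cone around the first axis, split by the sign of \<open>m * n\<close> into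
    the target of the shear and the target of its inverse. Exchanging the coordinates gives the
    cones of \<open>y\<close>.\<close>
  define P :: "bool \<Rightarrow> (int \<times> int) set" where "P e = {(m, n). \<bar>n\<bar> < \<bar>m\<bar> \<and> (if e then m * n > 0 else m * n < 0)}" for e
  define W where "W l = (if snd l = x then P (fst l) else prod.swap ` P (fst l))" for l
  have sw: "p \<in> prod.swap ` R \<longleftrightarrow> prod.swap p \<in> R" for p :: "int \<times> int" and R
    by (metis image_iff swap_swap)
  show ?thesis
  proof (rule big_group_ping_pong[where S = "{x, y}" and x = x and y = y and \<phi> = \<phi> and W = W and m\<^sub>0 = "(1, 1)"])
    fix l :: "bool \<times> 'a" assume "snd l \<in> {x, y}"
    then obtain e where "l = (e, x) \<or> l = (e, y)" by (cases l) auto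
    then show "(1, 1) \<notin> W l" "\<phi> (if fst l then snd l else inv snd l) (1, 1) \<in> W l"
      using neq by (auto simp: W_def sw P_def x y inv_x inv_y shear_def)
  next
    fix k l :: "bool \<times> 'a" and p
    assume k: "snd k \<in> {x, y}" and l: "snd l \<in> {x, y}" and kl: "l \<noteq> (\<not> fst k, snd k)" and p: "p \<in> W k"
    obtain m n where mn: "p = (m, n)" by (cases p)
    obtain d where d: "k = (d, x) \<or> k = (d, y)" using k by (cases k) auto
    obtain e where e: "l = (e, x) \<or> l = (e, y)" using l by (cases l) auto
    have "\<phi> (if fst l then snd l else inv snd l) (m, n) \<in> W l"
      using d e kl p neq abs_add_mult_3[of m n] abs_add_mult_3[of n m]
        abs_diff_mult_3[of m n] abs_diff_mult_3[of n m] unfolding mn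
      by (elim disjE; cases d; cases e)
        (simp_all add: W_def sw P_def x y inv_x inv_y shear_def mult.commute)
    then show "\<phi> (if fst l then snd l else inv snd l) p \<in> W l" unfolding mn .
  qed (use xy neq one mult in auto)
qed

section \<open>Transport in local systems\<close>

text \<open>A parallel section of the local system pulled back along \<open>\<Phi>\<close>. The
  condition is local at each \<open>t\<close> because the maps \<open>\<tau>\<close> compose only
  between nearby points.\<close>

definition flat :: "('x \<Rightarrow> 'x \<Rightarrow> 'm \<Rightarrow> 'm) \<Rightarrow> 'k::topological_space set \<Rightarrow> ('k \<Rightarrow> 'x) \<Rightarrow> ('k \<Rightarrow> 'm) \<Rightarrow> bool" where
  "flat \<tau> K \<Phi> f \<longleftrightarrow> (\<forall>t\<in>K. \<forall>\<^sub>F y in at t within K. f y = \<tau> (\<Phi> t) (\<Phi> y) (f t))"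

lemma flatD: "flat \<tau> K \<Phi> f \<Longrightarrow> t \<in> K \<Longrightarrow> \<forall>\<^sub>F y in at t within K. f y = \<tau> (\<Phi> t) (\<Phi> y) (f t)"
  by (simp add: flat_def)

text \<open>Injectivity keeps \<open>e y\<close> different from \<open>e t\<close>, as the punctured
  filter in \<open>flat\<close> demands.\<close>

lemma flat_reparam:
  fixes e :: "'s::t1_space \<Rightarrow> 'k::t1_space"
  assumes f: "flat \<tau> K \<Phi> f" and e: "continuous_on S e" "inj_on e S" "e ` S \<subseteq> K"
  shows "flat \<tau> S (\<Phi> \<circ> e) (f \<circ> e)"
  unfolding flat_def
proof
  fix t assume t: "t \<in> S"
  have "\<forall>\<^sub>F y in at t within S. y \<in> S \<and> y \<noteq> t"
    by (simp add: eventually_at_filter)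
  then have "\<forall>\<^sub>F y in at t within S. e y \<in> K \<and> e y \<noteq> e t"
    by eventually_elim (use e(2,3) t in \<open>auto simp: inj_on_def\<close>)
  moreover have "(e \<longlongrightarrow> e t) (at t within S)"
    using e(1) t by (simp add: continuous_on_def)
  ultimately have "filterlim e (at (e t) within K) (at t within S)"
    by (simp add: filterlim_at)
  moreover have "e t \<in> K" using e(3) t by blast
  ultimately show "\<forall>\<^sub>F y in at t within S. (f \<circ> e) y = \<tau> ((\<Phi> \<circ> e) t) ((\<Phi> \<circ> e) y) ((f \<circ> e) t)"
    unfolding comp_def using eventually_compose_filterlim[OF flatD[OF f]] by blast
qed

lemma flat_cong:
  assumes f: "flat \<tau> K \<Phi> f" and "\<And>x. x \<in> K \<Longrightarrow> \<Phi> x = \<Psi> x" "\<And>x. x \<in> K \<Longrightarrow> f x = g x"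
  shows "flat \<tau> K \<Psi> g"
  unfolding flat_def
proof
  fix t assume t: "t \<in> K"
  have "\<forall>\<^sub>F y in at t within K. y \<in> K" by (simp add: eventually_at_filter)
  with flatD[OF f t] show "\<forall>\<^sub>F y in at t within K. g y = \<tau> (\<Psi> t) (\<Psi> y) (g t)"
    by eventually_elim (use assms(2,3) t in metis)
qed

text \<open>A point outside a closed piece has a neighbourhood missing it, so that piece imposes a
  vacuous condition there.\<close>

lemma flat_Un:
  assumes S: "closed S" "flat \<tau> S \<Phi> f" and T: "closed T" "flat \<tau> T \<Phi> f"
  shows "flat \<tau> (S \<union> T) \<Phi> f"
  unfolding flat_def at_within_union eventually_sup
proof (intro ballI conjI)
  fix t assume t: "t \<in> S \<union> T"
  have outside: "\<forall>\<^sub>F y in at t within R. P y" if "closed R" "t \<notin> R" for R P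
    unfolding eventually_at_topological
    by (rule exI[of _ "- R"]) (use that in \<open>auto simp: open_closed\<close>)
  show "\<forall>\<^sub>F y in at t within S. f y = \<tau> (\<Phi> t) (\<Phi> y) (f t)"
    using flatD[OF S(2)] outside[OF S(1)] by blast
  show "\<forall>\<^sub>F y in at t within T. f y = \<tau> (\<Phi> t) (\<Phi> y) (f t)"
    using flatD[OF T(2)] outside[OF T(1)] by blast
qed

text \<open>A locally constant sheaf given by transition maps \<open>\<tau> x y\<close> from the
  fibre at \<open>x\<close> to the fibre at \<open>y\<close>. They compose only inside small open
  sets; their failure to compose along a whole loop is the monodromy.\<close>

locale local_system =
  fixes X :: "'x::topological_space set" and \<tau> :: "'x \<Rightarrow> 'x \<Rightarrow> 'm \<Rightarrow> 'm"
  assumes local_cocycle: "x \<in> X \<Longrightarrow> \<exists>U. open U \<and> x \<in> U \<and> (\<forall>y\<in>U \<inter> X. \<tau> y y = id) \<and>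
    (\<forall>y\<in>U \<inter> X. \<forall>z\<in>U \<inter> X. \<forall>w\<in>U \<inter> X. \<tau> z w \<circ> \<tau> y z = \<tau> y w)"
begin

lemma flat_const: "x \<in> X \<Longrightarrow> flat \<tau> K (\<lambda>_. x) (\<lambda>_. m)"
proof -
  assume "x \<in> X"
  then have "\<tau> x x = id" using local_cocycle[of x] by auto
  then show ?thesis by (simp add: flat_def)
qed

section \<open>Uniqueness and existence of flat sections\<close>

definition cocycle_on :: "('k \<Rightarrow> 'x) \<Rightarrow> 'k set \<Rightarrow> bool" where
  "cocycle_on \<Phi> V \<longleftrightarrow> (\<forall>y\<in>V. \<forall>m. \<tau> (\<Phi> y) (\<Phi> y) m = m) \<and>
    (\<forall>y\<in>V. \<forall>z\<in>V. \<forall>w\<in>V. \<forall>m. \<tau> (\<Phi> z) (\<Phi> w) (\<tau> (\<Phi> y) (\<Phi> z) m) = \<tau> (\<Phi> y) (\<Phi> w) m)"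

lemma cocycle_on_subset: "cocycle_on \<Phi> V \<Longrightarrow> U \<subseteq> V \<Longrightarrow> cocycle_on \<Phi> U"
  unfolding cocycle_on_def by blast

lemma cocycle_on_id: "cocycle_on \<Phi> V \<Longrightarrow> y \<in> V \<Longrightarrow> \<tau> (\<Phi> y) (\<Phi> y) m = m"
  unfolding cocycle_on_def by blast

lemma cocycle_on_trans:
  "cocycle_on \<Phi> V \<Longrightarrow> y \<in> V \<Longrightarrow> z \<in> V \<Longrightarrow> w \<in> V \<Longrightarrow>
    \<tau> (\<Phi> z) (\<Phi> w) (\<tau> (\<Phi> y) (\<Phi> z) m) = \<tau> (\<Phi> y) (\<Phi> w) m"
  unfolding cocycle_on_def by blast

lemma local_cocycle_pullback:
  fixes K :: "'k::topological_space set"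
  assumes "continuous_on K \<Phi>" "\<Phi> ` K \<subseteq> X" "t \<in> K"
  shows "\<exists>V. open V \<and> t \<in> V \<and> cocycle_on \<Phi> (V \<inter> K)"
proof -
  have "\<Phi> t \<in> X" using assms(2,3) by blast
  from local_cocycle[OF this] obtain U where U: "open U" "\<Phi> t \<in> U" "\<forall>y\<in>U \<inter> X. \<tau> y y = id"
    "\<forall>y\<in>U \<inter> X. \<forall>z\<in>U \<inter> X. \<forall>w\<in>U \<inter> X. \<tau> z w \<circ> \<tau> y z = \<tau> y w"
    by (elim exE conjE)
  obtain V where V: "open V" "t \<in> V" "\<And>y. y \<in> K \<Longrightarrow> y \<in> V \<Longrightarrow> \<Phi> y \<in> U"
    using assms(1)[unfolded continuous_on_topological, rule_format, OF assms(3) U(1,2)] by (elim exE conjE) simp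
  have mem: "\<Phi> y \<in> U \<inter> X" if "y \<in> V \<inter> K" for y using that V(3) assms(2) by auto
  have "cocycle_on \<Phi> (V \<inter> K)"
    unfolding cocycle_on_def
  proof (intro conjI ballI allI)
    fix y m assume "y \<in> V \<inter> K"
    then show "\<tau> (\<Phi> y) (\<Phi> y) m = m" using U(3) mem by simp
  next
    fix y z w m assume "y \<in> V \<inter> K" "z \<in> V \<inter> K" "w \<in> V \<inter> K"
    then have "\<tau> (\<Phi> z) (\<Phi> w) \<circ> \<tau> (\<Phi> y) (\<Phi> z) = \<tau> (\<Phi> y) (\<Phi> w)"
      using U(4) mem by simp
    then show "\<tau> (\<Phi> z) (\<Phi> w) (\<tau> (\<Phi> y) (\<Phi> z) m) = \<tau> (\<Phi> y) (\<Phi> w) m"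
      by (metis comp_apply)
  qed
  then show ?thesis using V(1,2) by (intro exI[of _ V] conjI)
qed

text \<open>Agreement of two flat sections is locally constant: near \<open>t\<close> both are
  images of their values at \<open>t\<close> under the same invertible map.\<close>

lemma flat_unique:
  fixes K :: "'k::topological_space set"
  assumes K: "connected K" and \<Phi>: "continuous_on K \<Phi>" "\<Phi> ` K \<subseteq> X"
    and f: "flat \<tau> K \<Phi> f" and g: "flat \<tau> K \<Phi> g" and ab: "a \<in> K" "b \<in> K" "f a = g a"
  shows "f b = g b"
proof (rule connected_induction_simple[where P = "\<lambda>t. f t = g t", OF K ab])
  fix t assume t: "t \<in> K"
  obtain V where V: "open V" "t \<in> V" and coc: "cocycle_on \<Phi> (V \<inter> K)"
    using local_cocycle_pullback[OF \<Phi> t] by (elim exE conjE)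
  have "\<forall>\<^sub>F y in at t within K. f y = \<tau> (\<Phi> t) (\<Phi> y) (f t) \<and> g y = \<tau> (\<Phi> t) (\<Phi> y) (g t)"
    using f g t unfolding flat_def by (simp add: eventually_conj)
  then obtain S where S: "open S" "t \<in> S"
    "\<And>y. y \<in> S \<Longrightarrow> y \<noteq> t \<Longrightarrow> y \<in> K \<Longrightarrow> f y = \<tau> (\<Phi> t) (\<Phi> y) (f t) \<and> g y = \<tau> (\<Phi> t) (\<Phi> y) (g t)"
    unfolding eventually_at_topological by blast
  have tV: "t \<in> V \<inter> K" using t V(2) by simp
  have iff: "f y = g y \<longleftrightarrow> f t = g t" if y: "y \<in> S" "y \<in> V \<inter> K" for y
  proof (cases "y = t")
    case False
    then have eq: "f y = \<tau> (\<Phi> t) (\<Phi> y) (f t)" "g y = \<tau> (\<Phi> t) (\<Phi> y) (g t)"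
      using S(3) y by auto
    have inverse: "\<tau> (\<Phi> y) (\<Phi> t) (\<tau> (\<Phi> t) (\<Phi> y) m) = m" for m
      using cocycle_on_trans[OF coc tV y(2) tV] cocycle_on_id[OF coc tV] by simp
    show ?thesis
    proof
      assume "f y = g y"
      then have "\<tau> (\<Phi> y) (\<Phi> t) (\<tau> (\<Phi> t) (\<Phi> y) (f t)) = \<tau> (\<Phi> y) (\<Phi> t) (\<tau> (\<Phi> t) (\<Phi> y) (g t))"
        unfolding eq by simp
      then show "f t = g t" unfolding inverse .
    qed (simp add: eq)
  qed simp
  have "openin (top_of_set K) (K \<inter> (S \<inter> V))"
    using S(1) V(1) by (intro openin_open_Int open_Int)
  moreover have "t \<in> K \<inter> (S \<inter> V)" using S(2) V(2) t by simp
  moreover have "\<forall>x\<in>K \<inter> (S \<inter> V). \<forall>y\<in>K \<inter> (S \<inter> V). f x = g x \<longrightarrow> f y = g y"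
  proof (intro ballI impI)
    fix x y assume "x \<in> K \<inter> (S \<inter> V)" "y \<in> K \<inter> (S \<inter> V)" "f x = g x"
    then show "f y = g y" using iff[of x] iff[of y] by simp
  qed
  ultimately show "\<exists>T. openin (top_of_set K) T \<and> t \<in> T \<and> (\<forall>x\<in>T. \<forall>y\<in>T. f x = g x \<longrightarrow> f y = g y)"
    by (intro exI[of _ "K \<inter> (S \<inter> V)"] conjI)
qed

text \<open>The value of the section at \<open>x\<close> is obtained by transporting \<open>m\<close> in finitely many
  steps along the segment from \<open>c\<close> to \<open>x\<close>; flatness is the cocycle identity for the ladder between
  two neighbouring segments.\<close>

lemma flat_exists:
  fixes K :: "'k::real_normed_vector set"
  assumes K: "compact K" "convex K" "c \<in> K" and \<Phi>: "continuous_on K \<Phi>" "\<Phi> ` K \<subseteq> X"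
  obtains f where "flat \<tau> K \<Phi> f" "f c = m"
proof -
  let ?C = "{V. open V \<and> cocycle_on \<Phi> (V \<inter> K)}"
  have "K \<subseteq> \<Union>?C"
  proof
    fix t assume "t \<in> K"
    from local_cocycle_pullback[OF \<Phi> this] obtain V where "open V" "t \<in> V" "cocycle_on \<Phi> (V \<inter> K)"
      by (elim exE conjE)
    then show "t \<in> \<Union>?C" by blast
  qed
  then obtain \<epsilon> where \<epsilon>: "\<epsilon> > 0" "\<And>x. x \<in> K \<Longrightarrow> \<exists>V\<in>?C. ball x \<epsilon> \<subseteq> V"
    by (rule Heine_Borel_lemma[OF K(1)]) auto
  have coc: "cocycle_on \<Phi> (ball x \<epsilon> \<inter> K)" if x: "x \<in> K" for x
  proof -
    obtain V where V: "cocycle_on \<Phi> (V \<inter> K)" "ball x \<epsilon> \<subseteq> V" using \<epsilon>(2)[OF x] by auto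
    then show ?thesis using cocycle_on_subset[OF V(1), of "ball x \<epsilon> \<inter> K"] V(2) by blast
  qed
  have idm: "\<tau> (\<Phi> y) (\<Phi> y) m = m" if "y \<in> K" for y
    using cocycle_on_id[OF coc[OF that]] \<epsilon>(1) that by simp
  obtain B where B: "\<And>x. x \<in> K \<Longrightarrow> dist c x \<le> B"
    using compact_imp_bounded[OF K(1)] unfolding bounded_any_center[of _ c] by blast
  \<comment> \<open>Steps shorter than half the Lebesgue number \<open>\<epsilon>\<close>: for end
    points closer than \<open>\<epsilon> / 2\<close>, the four corners of each cell between two
    segments then lie in one ball on which the transition maps compose.\<close>
  obtain N :: nat where N: "N > 0" "B / real N < \<epsilon> / 2"
  proof -
    obtain N :: nat where "2 * \<bar>B\<bar> / \<epsilon> < real N" using reals_Archimedean2 by blast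
    then have "\<bar>B\<bar> < real (Suc N) * (\<epsilon> / 2)" using \<epsilon>(1) by (simp add: field_simps)
    then have "B / real (Suc N) < \<epsilon> / 2" by (simp add: field_simps)
    then show ?thesis using that by blast
  qed
  define p where "p x j = c + (real j / real N) *\<^sub>R (x - c)" for x and j :: nat
  have pK: "p x j \<in> K" if "x \<in> K" "j \<le> N" for x j
  proof -
    have "(1 - real j / real N) *\<^sub>R c + (real j / real N) *\<^sub>R x \<in> K"
      using K that N(1) by (intro convexD) auto
    then show ?thesis by (simp add: p_def algebra_simps)
  qed
  have step: "dist (p x j) (p x (Suc j)) < \<epsilon> / 2" if "x \<in> K" for x j
  proof -
    have "p x (Suc j) - p x j = (1 / real N) *\<^sub>R (x - c)"
      by (simp add: p_def scaleR_diff_left[symmetric] diff_divide_distrib[symmetric])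
    then have "dist (p x j) (p x (Suc j)) = dist c x / real N"
      by (metis dist_commute dist_norm norm_scaleR abs_of_nonneg divide_inverse mult.commute mult_1 of_nat_0_le_iff zero_le_divide_1_iff)
    also have "\<dots> \<le> B / real N" using B[OF that] N(1) by (simp add: divide_right_mono)
    also have "\<dots> < \<epsilon> / 2" by (rule N(2))
    finally show ?thesis .
  qed
  have near: "dist (p x j) (p y j) \<le> dist x y" if "j \<le> N" for x y j
  proof -
    have "p x j - p y j = (real j / real N) *\<^sub>R (x - y)" by (simp add: p_def algebra_simps)
    then have "dist (p x j) (p y j) = real j / real N * dist x y" by (simp add: dist_norm)
    also have "\<dots> \<le> 1 * dist x y" using that N(1) by (intro mult_right_mono) auto
    finally show ?thesis by simp
  qed
  define g where "g x = rec_nat m (\<lambda>j. \<tau> (\<Phi> (p x j)) (\<Phi> (p x (Suc j))))" for x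
  have g_0: "g x 0 = m" and g_Suc: "g x (Suc j) = \<tau> (\<Phi> (p x j)) (\<Phi> (p x (Suc j))) (g x j)" for x j
    by (simp_all add: g_def)
  have ladder: "g y j = \<tau> (\<Phi> (p x j)) (\<Phi> (p y j)) (g x j)"
    if xy: "x \<in> K" "y \<in> K" "dist x y < \<epsilon> / 2" and j: "j \<le> N" for x y j
    using j
  proof (induction j)
    case 0
    have "p x 0 = c" "p y 0 = c" by (simp_all add: p_def)
    then show ?case using idm[OF K(3)] by (simp add: g_0)
  next
    case (Suc j)
    have "p x j \<in> K" "p x (Suc j) \<in> K" "p y j \<in> K" "p y (Suc j) \<in> K"
      using pK xy Suc.prems by auto
    moreover have "dist (p x j) (p x (Suc j)) < \<epsilon>" using step[OF xy(1), of j] \<epsilon>(1) by simp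
    moreover have "dist (p x j) (p y j) < \<epsilon>" using near[of j x y] Suc.prems xy(3) \<epsilon>(1) by simp
    moreover have "dist (p x j) (p y (Suc j)) < \<epsilon>"
      using near[of j x y] step[OF xy(2), of j] Suc.prems xy(3)
        dist_triangle[of "p x j" "p y (Suc j)" "p y j"] by simp
    ultimately have mem: "p x j \<in> ball (p x j) \<epsilon> \<inter> K" "p x (Suc j) \<in> ball (p x j) \<epsilon> \<inter> K"
      "p y j \<in> ball (p x j) \<epsilon> \<inter> K" "p y (Suc j) \<in> ball (p x j) \<epsilon> \<inter> K" and x: "p x j \<in> K"
      using \<epsilon>(1) by simp_all
    note trans = cocycle_on_trans[OF coc[OF x]]
    have "g y (Suc j) = \<tau> (\<Phi> (p y j)) (\<Phi> (p y (Suc j))) (\<tau> (\<Phi> (p x j)) (\<Phi> (p y j)) (g x j))"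
      using Suc by (simp add: g_Suc)
    also have "\<dots> = \<tau> (\<Phi> (p x j)) (\<Phi> (p y (Suc j))) (g x j)"
      by (rule trans[OF mem(1,3,4)])
    also have "\<dots> = \<tau> (\<Phi> (p x (Suc j))) (\<Phi> (p y (Suc j))) (g x (Suc j))"
      unfolding g_Suc by (rule trans[OF mem(1,2,4), symmetric])
    finally show ?case .
  qed
  have pN: "p x N = x" for x using N(1) by (simp add: p_def)
  show ?thesis
  proof (rule that[of "\<lambda>x. g x N"])
    show "flat \<tau> K \<Phi> (\<lambda>x. g x N)"
      unfolding flat_def eventually_at
    proof (intro ballI exI[of _ "\<epsilon> / 2"] conjI impI)
      fix t y assume "t \<in> K" "y \<in> K" "y \<noteq> t \<and> dist y t < \<epsilon> / 2"
      then show "g y N = \<tau> (\<Phi> t) (\<Phi> y) (g t N)"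
        using ladder[of t y N] by (simp add: pN dist_commute)
    qed (use \<epsilon>(1) in simp)
    have "p c j = c" for j by (simp add: p_def)
    then have "g c j = m" for j by (induction j) (simp_all add: g_0 g_Suc idm K(3))
    then show "g c N = m" .
  qed
qed

section \<open>Parallel transport along paths and its homotopy invariance\<close>

definition transport :: "(real \<Rightarrow> 'x) \<Rightarrow> 'm \<Rightarrow> 'm" where
  "transport \<gamma> m = (SOME m'. \<exists>f. flat \<tau> {0..1} \<gamma> f \<and> f 0 = m \<and> f 1 = m')"

lemma transport_eqI:
  assumes \<gamma>: "path \<gamma>" "path_image \<gamma> \<subseteq> X" and f: "flat \<tau> {0..1} \<gamma> f" "f 0 = m" "f 1 = m'"
  shows "transport \<gamma> m = m'"
  unfolding transport_def
proof (rule some_equality)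
  fix m'' assume "\<exists>f. flat \<tau> {0..1} \<gamma> f \<and> f 0 = m \<and> f 1 = m''"
  then obtain g where g: "flat \<tau> {0..1} \<gamma> g" "g 0 = m" "g 1 = m''" by blast
  have "g 1 = f 1"
    by (rule flat_unique[OF _ _ _ g(1) f(1), of 0]) (use \<gamma> f g in \<open>auto simp: path_def path_image_def\<close>)
  then show "m'' = m'" using f g by simp
qed (use f in blast)

lemma transport_flat:
  assumes "path \<gamma>" "path_image \<gamma> \<subseteq> X"
  obtains f where "flat \<tau> {0..1} \<gamma> f" "f 0 = m" "f 1 = transport \<gamma> m"
proof -
  obtain f where f: "flat \<tau> {0..1} \<gamma> f" "f 0 = m"
  proof (rule flat_exists[of "{0..1::real}" 0 \<gamma> m])
    show "continuous_on {0..1} \<gamma>" "\<gamma> ` {0..1} \<subseteq> X"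
      using assms by (auto simp: path_def path_image_def)
  qed auto
  then show ?thesis using that transport_eqI[OF assms f refl] by simp
qed

lemma transport_const:
  assumes "x \<in> X"
  shows "transport (\<lambda>_. x) m = m"
  by (rule transport_eqI[OF _ _ flat_const[OF assms] refl refl])
    (use assms in \<open>auto simp: path_def path_image_def\<close>)

lemma transport_reversepath:
  assumes \<gamma>: "path \<gamma>" "path_image \<gamma> \<subseteq> X"
  shows "transport (reversepath \<gamma>) (transport \<gamma> m) = m"
proof -
  obtain f where f: "flat \<tau> {0..1} \<gamma> f" "f 0 = m" "f 1 = transport \<gamma> m"
    using transport_flat[OF \<gamma>] by blast
  have "flat \<tau> {0..1} (\<gamma> \<circ> (\<lambda>t. 1 - t)) (f \<circ> (\<lambda>t. 1 - t))"
    by (rule flat_reparam[OF f(1)]) (auto intro!: continuous_intros inj_onI)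
  then have "flat \<tau> {0..1} (reversepath \<gamma>) (\<lambda>t. f (1 - t))"
    by (simp add: reversepath_def comp_def)
  then show ?thesis
    by (rule transport_eqI[rotated 2]) (simp_all add: f \<gamma>)
qed

lemma transport_join:
  assumes \<gamma>: "path \<gamma>" "path_image \<gamma> \<subseteq> X" and \<delta>: "path \<delta>" "path_image \<delta> \<subseteq> X"
    and eq: "pathfinish \<gamma> = pathstart \<delta>"
  shows "transport (\<gamma> +++ \<delta>) m = transport \<delta> (transport \<gamma> m)"
proof -
  obtain f where f: "flat \<tau> {0..1} \<gamma> f" "f 0 = m" "f 1 = transport \<gamma> m"
    using transport_flat[OF \<gamma>] by blast
  obtain g where g: "flat \<tau> {0..1} \<delta> g" "g 0 = transport \<gamma> m" "g 1 = transport \<delta> (transport \<gamma> m)"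
    using transport_flat[OF \<delta>] by blast
  have \<gamma>1: "\<gamma> 1 = \<delta> 0" using eq by (simp add: pathfinish_def pathstart_def)
  define h where "h t = (if t \<le> 1/2 then f (2 * t) else g (2 * t - 1))" for t
  have h1: "h t = f (2 * t)" "(\<gamma> +++ \<delta>) t = \<gamma> (2 * t)" if "t \<in> {0..1/2}" for t
    using that by (auto simp: h_def joinpaths_def)
  have h2: "h t = g (2 * t - 1)" "(\<gamma> +++ \<delta>) t = \<delta> (2 * t - 1)" if t: "t \<in> {1/2..1}" for t
  proof -
    consider "t = 1/2" | "t > 1/2" using t by fastforce
    then have "h t = g (2 * t - 1) \<and> (\<gamma> +++ \<delta>) t = \<delta> (2 * t - 1)"
    proof cases
      case 1
      show ?thesis unfolding 1 by (simp add: h_def joinpaths_def f(3) g(2) \<gamma>1)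
    qed (simp add: h_def joinpaths_def)
    then show "h t = g (2 * t - 1)" "(\<gamma> +++ \<delta>) t = \<delta> (2 * t - 1)" by simp_all
  qed
  have "flat \<tau> {0..1/2} (\<gamma> \<circ> (\<lambda>t. 2 * t)) (f \<circ> (\<lambda>t. 2 * t))"
    by (rule flat_reparam[OF f(1)]) (auto intro!: continuous_intros inj_onI)
  then have left: "flat \<tau> {0..1/2} (\<gamma> +++ \<delta>) h"
    by (rule flat_cong) (simp_all add: h1)
  have "flat \<tau> {1/2..1} (\<delta> \<circ> (\<lambda>t. 2 * t - 1)) (g \<circ> (\<lambda>t. 2 * t - 1))"
    by (rule flat_reparam[OF g(1)]) (auto intro!: continuous_intros inj_onI)
  then have right: "flat \<tau> {1/2..1} (\<gamma> +++ \<delta>) h"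
    by (rule flat_cong) (simp_all add: h2)
  have "flat \<tau> ({0..1/2} \<union> {1/2..1}) (\<gamma> +++ \<delta>) h"
    by (intro flat_Un left right) auto
  moreover have "{0..1/2} \<union> {1/2..1} = {0..1::real}" by auto
  ultimately have "flat \<tau> {0..1} (\<gamma> +++ \<delta>) h" by simp
  then show ?thesis
    by (rule transport_eqI[rotated 2]) (use f(2) g(3) \<gamma> \<delta> eq in \<open>auto simp: h_def path_image_join\<close>)
qed

text \<open>A flat section over the square of the homotopy restricts to flat sections on its sides.
  On the two sides where the homotopy is constant it is constant, so \<open>p\<close> and
  \<open>q\<close> share initial and final values. Allowing \<open>Y\<close> smaller than
  \<open>X\<close> lets homotopies avoid the lines while the local system ignores them.\<close>

lemma transport_homotopic:
  assumes "homotopic_paths Y p q" "Y \<subseteq> X"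
  shows "transport p m = transport q m"
proof -
  let ?K = "{0..1} \<times> {0..1::real}"
  obtain h :: "real \<times> real \<Rightarrow> 'x" where h: "continuous_on ?K h" "h ` ?K \<subseteq> X"
    "\<And>x. x \<in> {0..1} \<Longrightarrow> h (0, x) = p x" "\<And>x. x \<in> {0..1} \<Longrightarrow> h (1, x) = q x"
    "\<And>t. t \<in> {0..1::real} \<Longrightarrow> h (t, 0) = p 0" "\<And>t. t \<in> {0..1::real} \<Longrightarrow> h (t, 1) = p 1"
  proof -
    obtain h :: "real \<times> real \<Rightarrow> 'x" where h: "continuous_on ?K h" "h \<in> ?K \<rightarrow> Y" "\<forall>x\<in>{0..1}. h (0, x) = p x"
      "\<forall>x\<in>{0..1}. h (1, x) = q x"
      "\<forall>t\<in>{0..1}. pathstart (h \<circ> Pair t) = pathstart p \<and> pathfinish (h \<circ> Pair t) = pathfinish p"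
      using assms(1) unfolding homotopic_paths by blast
    show ?thesis
    proof (rule that[of h])
      show "h ` ?K \<subseteq> X" using h(2) assms(2) by blast
      show "h (t, 0) = p 0" "h (t, 1) = p 1" if "t \<in> {0..1}" for t
        using h(5) that by (simp_all add: pathstart_def pathfinish_def)
    qed (use h in blast)+
  qed
  have paths: "path p" "path q" "path_image p \<subseteq> X" "path_image q \<subseteq> X"
    using homotopic_paths_imp_path[OF assms(1)] homotopic_paths_imp_subset[OF assms(1)] assms(2) by auto
  obtain F where F: "flat \<tau> ?K h F" "F (0, 0) = m"
    by (rule flat_exists[OF _ _ _ h(1,2)]) (auto intro: compact_Times convex_Times)
  have restrict: "flat \<tau> {0..1} \<Phi> (F \<circ> e)"
    if "continuous_on {0..1} e" "inj_on e {0..1}" "e ` {0..1} \<subseteq> ?K" "\<And>x. x \<in> {0..1} \<Longrightarrow> h (e x) = \<Phi> x"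
    for \<Phi> and e :: "real \<Rightarrow> real \<times> real"
    by (rule flat_cong[OF flat_reparam[OF F(1) that(1-3)]]) (simp_all add: that(4))
  have p: "flat \<tau> {0..1} p (F \<circ> (\<lambda>x. (0, x)))"
    by (rule restrict) (use h(3) in \<open>auto intro!: continuous_intros inj_onI\<close>)
  have q: "flat \<tau> {0..1} q (F \<circ> (\<lambda>x. (1, x)))"
    by (rule restrict) (use h(4) in \<open>auto intro!: continuous_intros inj_onI\<close>)
  have X: "p 0 \<in> X" "p 1 \<in> X" using paths(3) by (auto simp: path_image_def)
  have const: "f 1 = f 0" if "flat \<tau> {0..1} (\<lambda>_. x) f" "x \<in> X" for x and f :: "real \<Rightarrow> 'm"
  proof -
    have "transport (\<lambda>_. x) (f 0) = f 1"
      by (rule transport_eqI[OF _ _ that(1) refl refl]) (use that(2) in \<open>auto simp: path_def path_image_def\<close>)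
    then show ?thesis using transport_const[OF that(2)] by simp
  qed
  have "flat \<tau> {0..1} (\<lambda>_. p 0) (F \<circ> (\<lambda>t. (t, 0)))"
    by (rule restrict) (use h(5) in \<open>auto intro!: continuous_intros inj_onI\<close>)
  from const[OF this X(1)] have 0: "F (1, 0) = m" using F(2) by simp
  have "flat \<tau> {0..1} (\<lambda>_. p 1) (F \<circ> (\<lambda>t. (t, 1)))"
    by (rule restrict) (use h(6) in \<open>auto intro!: continuous_intros inj_onI\<close>)
  from const[OF this X(2)] have 1: "F (1, 1) = F (0, 1)" by simp
  have "transport p m = F (0, 1)"
    by (rule transport_eqI[OF paths(1,3) p]) (simp_all add: F)
  moreover have "transport q m = F (1, 1)"
    by (rule transport_eqI[OF paths(2,4) q]) (simp_all add: 0)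
  ultimately show ?thesis using 1 by simp
qed

end

section \<open>Curves in the projective plane\<close>

lemma continuous_on_smult_vec [continuous_intros]:
  fixes f :: "'a::topological_space \<Rightarrow> complex" and g :: "'a \<Rightarrow> complex^'n"
  assumes "continuous_on S f" "continuous_on S g"
  shows "continuous_on S (\<lambda>x. f x *s g x)"
  unfolding vector_scalar_mult_def by (intro continuous_intros assms)

lemma cp2_point_smult: "c \<noteq> 0 \<Longrightarrow> v \<noteq> 0 \<Longrightarrow> cp2_point (c *s v) = cp2_point v"
  by (rule sym, subst cp2_point_eq_iff) auto

lemma continuous_on_cp2_point: "continuous_on (- {0}) cp2_point"
proof -
  have "open (cp2_point -` B \<inter> - {0})" if "open B" for B
  proof -
    have "cp2_point -` B \<inter> - {0} = {x. x \<noteq> 0 \<and> cp2_point x \<in> B}" by auto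
    then show ?thesis using that by (simp add: open_cp2_def)
  qed
  then show ?thesis by (simp add: continuous_on_open_vimage open_Compl)
qed

text \<open>The saturation of \<open>N\<close> is the union of its preimages under all nonzero
  scalings.\<close>

lemma open_image_cp2_point:
  assumes N: "open N" "0 \<notin> N"
  shows "open (cp2_point ` N)"
proof -
  have "{x. x \<noteq> 0 \<and> cp2_point x \<in> cp2_point ` N} = (\<Union>c\<in>-{0}. (\<lambda>x. c *s x) -` N)"
  proof (intro equalityI subsetI)
    fix x assume "x \<in> {x. x \<noteq> 0 \<and> cp2_point x \<in> cp2_point ` N}"
    then obtain v where v: "x \<noteq> 0" "v \<in> N" "cp2_point x = cp2_point v" by auto
    then have "v \<noteq> 0" using N by auto
    then obtain c where "v = c *s x" using v cp2_point_eq_iff by blast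
    then show "x \<in> (\<Union>c\<in>-{0}. (\<lambda>x. c *s x) -` N)" using v(2) \<open>v \<noteq> 0\<close> by (cases "c = 0") auto
  next
    fix x assume "x \<in> (\<Union>c\<in>-{0}. (\<lambda>x. c *s x) -` N)"
    then obtain c where c: "c \<noteq> 0" "c *s x \<in> N" by auto
    then have "x \<noteq> 0" using N by auto
    then have "cp2_point x = cp2_point (c *s x)" using cp2_point_smult c by simp
    then show "x \<in> {x. x \<noteq> 0 \<and> cp2_point x \<in> cp2_point ` N}" using c \<open>x \<noteq> 0\<close> by blast
  qed
  moreover have "open ((\<lambda>x. c *s x) -` N)" for c
    by (rule open_vimage[OF N(1)]) (intro continuous_intros)
  ultimately show ?thesis unfolding open_cp2_def by (auto intro: open_UN)
qed

lemma cp2_point_mem_curve_iff: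
  assumes "\<And>c x. c \<noteq> 0 \<Longrightarrow> F (c *s x) = 0 \<longleftrightarrow> F x = 0" and v: "v \<noteq> 0"
  shows "cp2_point v \<in> curve F \<longleftrightarrow> F v = 0"
proof
  assume "cp2_point v \<in> curve F"
  then obtain x where x: "x \<noteq> 0" "F x = 0" "cp2_point v = cp2_point x" by (auto simp: curve_def)
  then obtain c where "x = c *s v" using cp2_point_eq_iff v by blast
  then show "F v = 0" using x assms(1)[of c v] by (cases "c = 0") auto
qed (use v in \<open>auto simp: curve_def\<close>)

text \<open>Join two points inside the complex line through their representatives. Each equation
  restricts to a polynomial that is nonzero at the parameter 0, so only finitely many parameters are
  forbidden, and the complex plane minus a finite set is path connected.\<close>

lemma path_connected_Compl_curves:
  assumes fin: "finite \<F>" and F\<^sub>0: "F\<^sub>0 \<in> \<F>" "F\<^sub>0 0 = 0"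
    and scale: "\<And>F c x. F \<in> \<F> \<Longrightarrow> c \<noteq> 0 \<Longrightarrow> F (c *s x) = 0 \<longleftrightarrow> F x = 0"
    and poly: "\<And>F u v. F \<in> \<F> \<Longrightarrow> \<exists>p. \<forall>t. F (u + t *s v) = poly p t"
  shows "path_connected (- (\<Union>F\<in>\<F>. curve F))"
proof -
  let ?T = "\<Union>F\<in>\<F>. curve F"
  have mem: "cp2_point v \<notin> ?T \<longleftrightarrow> (\<forall>F\<in>\<F>. F v \<noteq> 0)" if "v \<noteq> 0" for v
  proof -
    have "cp2_point v \<in> curve F \<longleftrightarrow> F v = 0" if "F \<in> \<F>" for F
      by (rule cp2_point_mem_curve_iff) (use scale[OF that] \<open>v \<noteq> 0\<close> in auto)
    then show ?thesis by auto
  qed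
  show ?thesis
    unfolding path_connected_def
  proof (intro ballI)
    fix P R assume PR: "P \<in> - ?T" "R \<in> - ?T"
    obtain u where u: "u \<noteq> 0" "P = cp2_point u" by (rule cp2_point_cases)
    obtain v where v: "v \<noteq> 0" "R = cp2_point v" by (rule cp2_point_cases)
    have u': "F u \<noteq> 0" if "F \<in> \<F>" for F using PR(1) mem[OF u(1)] that unfolding u(2) by auto
    have v': "F v \<noteq> 0" if "F \<in> \<F>" for F using PR(2) mem[OF v(1)] that unfolding v(2) by auto
    define l where "l t = u + t *s (v - u)" for t
    define Z where "Z = (\<Union>F\<in>\<F>. {t. F (l t) = 0})"
    have "finite {t. F (l t) = 0}" if F: "F \<in> \<F>" for F
    proof -
      obtain p where p: "\<And>t. F (l t) = poly p t" unfolding l_def using poly[OF F] by blast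
      have "poly p 0 \<noteq> 0" using p[of 0] u'[OF F] by (simp add: l_def)
      then have "p \<noteq> 0" by auto
      then show ?thesis unfolding p by (rule poly_roots_finite)
    qed
    then have "finite Z" unfolding Z_def using fin by blast
    then have "path_connected (- Z)"
      by (intro path_connected_complement_countable countable_finite) simp_all
    moreover have "0 \<in> - Z" "1 \<in> - Z" unfolding Z_def l_def using u' v' by auto
    ultimately obtain h where h: "path h" "path_image h \<subseteq> - Z" "pathstart h = 0" "pathfinish h = 1"
      unfolding path_connected_def by blast
    \<comment> \<open>Since \<open>F\<^sub>0\<close> vanishes at the origin, a parameter with
      \<open>l t = 0\<close> already belongs to \<open>Z\<close>.\<close>
    have nz: "l t \<noteq> 0" if "t \<in> - Z" for t using that F\<^sub>0 by (auto simp: Z_def)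
    have out: "cp2_point (l t) \<in> - ?T" if "t \<in> - Z" for t
      using mem[OF nz[OF that]] that by (auto simp: Z_def)
    have "continuous_on (- Z) l" unfolding l_def by (intro continuous_intros)
    moreover have "continuous_on (l ` (- Z)) cp2_point"
      by (rule continuous_on_subset[OF continuous_on_cp2_point]) (use nz in auto)
    ultimately have "continuous_on (- Z) (cp2_point \<circ> l)" by (rule continuous_on_compose)
    then have "continuous_on (path_image h) (cp2_point \<circ> l)"
      using h(2) by (rule continuous_on_subset)
    with h(1) have "path (cp2_point \<circ> l \<circ> h)" by (rule path_continuous_image)
    moreover have "path_image (cp2_point \<circ> l \<circ> h) \<subseteq> - ?T"
      using h(2) out by (auto simp: path_image_def)
    moreover have "pathstart (cp2_point \<circ> l \<circ> h) = P" "pathfinish (cp2_point \<circ> l \<circ> h) = R"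
      using h(3,4) u v by (simp_all add: pathstart_def pathfinish_def l_def)
    ultimately show "\<exists>g. path g \<and> path_image g \<subseteq> - ?T \<and> pathstart g = P \<and> pathfinish g = R"
      by (intro exI[of _ "cp2_point \<circ> l \<circ> h"] conjI)
  qed
qed

section \<open>The local system of a pencil of bitangent conics\<close>

definition side :: "complex \<Rightarrow> int" where
  "side s = (if Re s \<ge> 0 then 0 else 1)"

text \<open>For nearby points, the signed crossing of the ray above \<open>\<i>\<close> on the
  imaginary axis, positive from right to left.\<close>

definition crossing :: "complex \<Rightarrow> complex \<Rightarrow> int" where
  "crossing s s' = (if Im s > 1 \<and> Im s' > 1 then side s' - side s else 0)"

text \<open>The second factor belongs to the ray below \<open>- \<i>\<close>, the mirror image under
  \<open>s\<close> to \<open>- s\<close>; conjugating it by the exchange makes the deck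
  transformation compatible with the transitions. For any pair at most one of the two shears is
  nontrivial.\<close>

definition slit :: "complex \<Rightarrow> complex \<Rightarrow> int \<times> int \<Rightarrow> int \<times> int" where
  "slit s s' = shear (crossing s s') \<circ> prod.swap \<circ> shear (crossing (- s) (- s')) \<circ> prod.swap"

lemma slit_refl [simp]: "slit s s = id"
  by (simp add: slit_def crossing_def swap_comp_swap)

lemma slit_uminus: "slit (- s) (- s') = prod.swap \<circ> slit s s' \<circ> prod.swap"
  by (auto simp: slit_def crossing_def fun_eq_iff)

lemma slit_right: "Re s > 0 \<Longrightarrow> Re s' > 0 \<Longrightarrow> slit s s' = id"
  by (simp add: slit_def crossing_def side_def swap_comp_swap)

lemma slit_left: "Re s < 0 \<Longrightarrow> Re s' < 0 \<Longrightarrow> slit s s' = id"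
  by (simp add: slit_def crossing_def side_def swap_comp_swap)

lemma slit_middle: "\<bar>Im s\<bar> < 1 \<Longrightarrow> slit s s' = id"
  by (auto simp: slit_def crossing_def swap_comp_swap abs_less_iff)

lemma slit_upper: "Im s > 1 \<Longrightarrow> Im s' > 1 \<Longrightarrow> slit s s' = shear (side s' - side s)"
  by (simp add: slit_def crossing_def comp_assoc swap_comp_swap)

lemma slit_lower:
  "Im s < - 1 \<Longrightarrow> Im s' < - 1 \<Longrightarrow> slit s s' = prod.swap \<circ> shear (side (- s') - side (- s)) \<circ> prod.swap"
  by (simp add: slit_def crossing_def)

text \<open>Five open regions cover everything except \<open>\<i>\<close> and \<open>- \<i>\<close>.
  On both half-planes and on the middle strip \<open>slit\<close> is the identity; above and below
  the strip it is a shear by a difference of values of \<open>side\<close>, which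
  telescopes.\<close>

lemma slit_local_cocycle:
  assumes "1 + s\<^sup>2 \<noteq> 0"
  obtains N where "open N" "s \<in> N"
    "\<And>x y z. x \<in> N \<Longrightarrow> y \<in> N \<Longrightarrow> z \<in> N \<Longrightarrow> slit y z \<circ> slit x y = slit x z"
proof -
  have "Re s > 0 \<or> Re s < 0 \<or> Im s > 1 \<or> Im s < - 1 \<or> \<bar>Im s\<bar> < 1"
  proof (rule ccontr)
    assume "\<not> ?thesis"
    then have "Re s = 0" "Im s = 1 \<or> Im s = - 1" by auto
    then have "s = \<i> \<or> s = - \<i>" by (auto simp: complex_eq_iff)
    then show False using assms by auto
  qed
  then consider "Re s > 0" | "Re s < 0" | "Im s > 1" | "Im s < - 1" | "\<bar>Im s\<bar> < 1" by blast
  then show ?thesis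
  proof cases
    case 1
    then show ?thesis
      by (intro that[of "{s. Re s > 0}"] open_halfspace_Re_gt) (simp_all add: slit_right)
  next
    case 2
    then show ?thesis
      by (intro that[of "{s. Re s < 0}"] open_halfspace_Re_lt) (simp_all add: slit_left)
  next
    case 3
    then show ?thesis
      by (intro that[of "{s. Im s > 1}"] open_halfspace_Im_gt) (simp_all add: slit_upper shear_comp_shear)
  next
    case 4
    have "slit y z \<circ> slit x y = slit x z" if "Im x < - 1" "Im y < - 1" "Im z < - 1" for x y z
    proof -
      have "slit y z \<circ> slit x y = prod.swap \<circ> (shear (side (- z) - side (- y)) \<circ> shear (side (- y) - side (- x))) \<circ> prod.swap"
        using that by (auto simp: slit_lower fun_eq_iff)
      then show ?thesis using that by (simp add: slit_lower shear_comp_shear)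
    qed
    then show ?thesis using 4
      by (intro that[of "{s. Im s < - 1}"] open_halfspace_Im_lt) simp_all
  next
    case 5
    have "{s. \<bar>Im s\<bar> < 1} = {s. Im s < 1} \<inter> {s. Im s > - 1}" by auto
    then have "open {s. \<bar>Im s\<bar> < 1}"
      by (simp add: open_Int open_halfspace_Im_lt open_halfspace_Im_gt)
    then show ?thesis using 5
      by (intro that[of "{s. \<bar>Im s\<bar> < 1}"]) (simp_all add: slit_middle)
  qed
qed

section \<open>The double cover and the local system below it\<close>

locale conic_pencil =
  fixes Q Z :: "complex^3 \<Rightarrow> complex"
  assumes Q_smult: "Q (c *s v) = c\<^sup>2 * Q v" and Z_smult: "Z (c *s v) = c * Z v"
    and continuous_Q: "continuous_on UNIV Q" and continuous_Z: "continuous_on UNIV Z"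
begin

text \<open>Representatives normalized by \<open>Q v = 1\<close>, on which the equation
  \<open>Q + Z^2\<close> of the second conic reads \<open>1 + Z^2\<close>.\<close>

definition Y :: "(complex^3) set" where
  "Y = {v. Q v = 1 \<and> 1 + (Z v)\<^sup>2 \<noteq> 0}"

definition lift :: "cp2 \<Rightarrow> complex^3" where
  "lift p = (SOME v. v \<in> Y \<and> cp2_point v = p)"

text \<open>The change of fibre coordinates between the representative \<open>v\<close> and the
  arbitrarily chosen lift of its point.\<close>

definition sheet :: "complex^3 \<Rightarrow> int \<times> int \<Rightarrow> int \<times> int" where
  "sheet v = (if lift (cp2_point v) = v then id else prod.swap)"

text \<open>Of the two representatives of \<open>p'\<close>, the one nearer to \<open>lift p\<close>
  lies on the same local sheet. If it is not the chosen lift, its \<open>Z\<close>-value is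
  \<open>- Z v'\<close> and the coordinates are exchanged.\<close>

definition \<tau> :: "cp2 \<Rightarrow> cp2 \<Rightarrow> int \<times> int \<Rightarrow> int \<times> int" where
  "\<tau> p p' = (let v = lift p; v' = lift p' in
     if dist v v' < dist v (- v') then slit (Z v) (Z v') else prod.swap \<circ> slit (Z v) (- Z v'))"

lemma Q_0: "Q 0 = 0"
  using Q_smult[of 0 0] by simp

lemma uminus_eq_smult: "- v = (- 1) *s v" for v :: "complex^3"
  by (simp add: vec_eq_iff)

lemma Q_uminus [simp]: "Q (- v) = Q v" and Z_uminus [simp]: "Z (- v) = - Z v"
  using Q_smult[of "- 1" v] Z_smult[of "- 1" v] by (simp_all add: uminus_eq_smult[symmetric])

lemma uminus_neq_self: "v \<noteq> 0 \<Longrightarrow> - v \<noteq> v" for v :: "complex^3"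
  by (auto simp: vec_eq_iff)

lemma Y_nonzero: "v \<in> Y \<Longrightarrow> v \<noteq> 0"
  using Q_0 by (auto simp: Y_def)

lemma Y_uminus: "v \<in> Y \<Longrightarrow> - v \<in> Y"
  by (simp add: Y_def)

lemma cp2_point_uminus: "v \<noteq> 0 \<Longrightarrow> cp2_point (- v) = cp2_point v"
  unfolding uminus_eq_smult by (rule cp2_point_smult) auto

lemma Q_eq_1_fibre:
  assumes "Q v = 1" "Q w = 1" "cp2_point v = cp2_point w"
  shows "w = v \<or> w = - v"
proof -
  have "v \<noteq> 0" "w \<noteq> 0" using assms Q_0 by auto
  then obtain c where c: "w = c *s v" using assms(3) cp2_point_eq_iff by blast
  then have "c\<^sup>2 = 1" using assms(1,2) Q_smult[of c v] by simp
  then have "c = 1 \<or> c = - 1" by (simp add: power2_eq_1_iff)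
  then show ?thesis unfolding c uminus_eq_smult by auto
qed

lemma lift_cp2_point:
  assumes "v \<in> Y"
  shows "lift (cp2_point v) = v \<or> lift (cp2_point v) = - v"
proof -
  have "lift (cp2_point v) \<in> Y \<and> cp2_point (lift (cp2_point v)) = cp2_point v"
    unfolding lift_def by (rule someI[of _ v]) (use assms in simp)
  then show ?thesis using Q_eq_1_fibre[of v "lift (cp2_point v)"] assms by (auto simp: Y_def)
qed

lemma sheet_sheet [simp]: "sheet v \<circ> sheet v = id"
  by (simp add: sheet_def swap_comp_swap)

lemma sheet_uminus:
  assumes "v \<in> Y"
  shows "sheet (- v) = prod.swap \<circ> sheet v"
proof -
  have "- v \<noteq> v" using uminus_neq_self[OF Y_nonzero[OF assms]] .
  then show ?thesis
    using lift_cp2_point[OF assms] cp2_point_uminus[OF Y_nonzero[OF assms]]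
    by (auto simp: sheet_def swap_comp_swap)
qed

text \<open>Frees the transition map from the chosen lifts: the \<open>sheet\<close> factors absorb
  the four combinations of signs, which \<open>slit_uminus\<close> makes consistent.\<close>

lemma \<tau>_cp2_point:
  assumes v: "v \<in> Y" and v': "v' \<in> Y" and near: "dist v v' < dist v (- v')"
  shows "\<tau> (cp2_point v) (cp2_point v') = sheet v' \<circ> slit (Z v) (Z v') \<circ> sheet v"
proof -
  have ne: "- v \<noteq> v" "- v' \<noteq> v'" using uminus_neq_self Y_nonzero v v' by blast+
  have d: "dist (- v) (- v') = dist v v'" "dist (- v) v' = dist v (- v')"
    by (simp_all add: dist_norm norm_minus_commute[of "- v" v'] add.commute)
       (metis diff_minus_eq_add minus_diff_eq norm_minus_cancel)+
  have far: "\<not> dist v (- v') < dist v v'" using near by simp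
  have neg: "slit (- Z v) (- Z v') = prod.swap \<circ> slit (Z v) (Z v') \<circ> prod.swap"
    by (rule slit_uminus)
  have neg': "prod.swap \<circ> (prod.swap \<circ> f) = f" for f :: "int \<times> int \<Rightarrow> int \<times> int"
    by (simp add: fun_eq_iff)
  consider "lift (cp2_point v) = v" "lift (cp2_point v') = v'"
    | "lift (cp2_point v) = v" "lift (cp2_point v') = - v'"
    | "lift (cp2_point v) = - v" "lift (cp2_point v') = v'"
    | "lift (cp2_point v) = - v" "lift (cp2_point v') = - v'"
    using lift_cp2_point[OF v] lift_cp2_point[OF v'] by blast
  then show ?thesis
    by cases (simp_all add: \<tau>_def sheet_def near far ne d neg neg' flip: o_assoc)
qed

text \<open>For representatives in a small ball, \<open>\<tau>\<close> is \<open>slit\<close> framed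
  by \<open>sheet\<close> factors; in a composition the inner factors cancel because
  \<open>sheet\<close> is an involution, and the cocycle law of \<open>slit\<close> remains.\<close>

sublocale local_system "cp2_point ` Y" \<tau>
proof
  fix p assume "p \<in> cp2_point ` Y"
  then obtain v where v: "v \<in> Y" "p = cp2_point v" by auto
  have Qv: "Q v = 1" "1 + (Z v)\<^sup>2 \<noteq> 0" using v by (auto simp: Y_def)
  obtain N where N: "open N" "Z v \<in> N"
    "\<And>x y z. x \<in> N \<Longrightarrow> y \<in> N \<Longrightarrow> z \<in> N \<Longrightarrow> slit y z \<circ> slit x y = slit x z"
    using slit_local_cocycle[OF Qv(2)] by blast
  \<comment> \<open>A continuous local section of the double cover: \<open>Q v = 1\<close>, so near
    \<open>v\<close> the values of \<open>Q\<close> stay in the right half-plane, where the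
    principal root is continuous.\<close>
  define nrm where "nrm x = (1 / csqrt (Q x)) *s x" for x
  let ?D = "{x. Re (Q x) > 0}"
  \<comment> \<open>Half the norm of \<open>v\<close> as radius keeps two points of the ball closer
    than \<open>norm v\<close> to each other, and each farther than \<open>norm v\<close> from the
    antipode of the other.\<close>
  define B where "B = ball v (norm v / 2) \<inter> Z -` N"
  define M where "M = ?D \<inter> nrm -` B"
  have D: "open ?D"
    by (intro open_Collect_less continuous_intros continuous_Q)
  have "continuous_on ?D nrm"
    unfolding nrm_def
    by (intro continuous_intros continuous_on_subset[OF continuous_Q] continuous_on_compose2[OF continuous_on_csqrt])
      (auto simp: complex_nonpos_Reals_iff)
  moreover have "open B"
    unfolding B_def by (intro open_Int open_ball open_vimage N continuous_Z)
  ultimately have "open M" unfolding M_def using D continuous_open_preimage by blast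
  have "0 \<notin> M" by (simp add: M_def Q_0)
  then have U: "open (cp2_point ` M)" using \<open>open M\<close> by (rule open_image_cp2_point[rotated])
  have "v \<in> M" using Y_nonzero[OF v(1)] N(2) Qv by (simp add: M_def B_def nrm_def)
  then have pU: "p \<in> cp2_point ` M" using v by blast
  have rep: "\<exists>u. u \<in> Y \<and> u \<in> B \<and> x = cp2_point u" if x: "x \<in> cp2_point ` M \<inter> cp2_point ` Y" for x
  proof -
    obtain w y where w: "w \<in> M" "x = cp2_point w" and y: "y \<in> Y" "x = cp2_point y" using x by auto
    have ne: "w \<noteq> 0" "csqrt (Q w) \<noteq> 0" using w(1) Q_0 by (auto simp: M_def)
    then have pt: "cp2_point (nrm w) = x" unfolding nrm_def w(2) by (intro cp2_point_smult) auto
    have "Q (nrm w) = 1" using ne by (simp add: nrm_def Q_smult power_divide)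
    then have "nrm w = y \<or> nrm w = - y"
      using Q_eq_1_fibre[of y "nrm w"] y pt by (auto simp: Y_def)
    then have "nrm w \<in> Y" using y(1) Y_uminus by auto
    then show ?thesis using pt w(1) by (auto simp: M_def)
  qed
  have near: "dist a b < dist a (- b)" if "a \<in> B" "b \<in> B" for a b
  proof -
    have a: "dist v a < norm v / 2" and b: "dist v b < norm v / 2" using that by (auto simp: B_def)
    have "dist a b < norm v" using a b dist_triangle[of a b v] by (simp add: dist_commute)
    moreover have "2 * norm v \<le> norm (a + b) + norm (v - a) + norm (v - b)"
    proof -
      have "2 * norm v = norm (2 *\<^sub>R v)" by simp
      also have "2 *\<^sub>R v = (a + b) + (v - a) + (v - b)" by (simp add: scaleR_2)
      also have "norm \<dots> \<le> norm ((a + b) + (v - a)) + norm (v - b)" by (rule norm_triangle_ineq)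
      also have "\<dots> \<le> norm (a + b) + norm (v - a) + norm (v - b)"
        by (intro add_right_mono norm_triangle_ineq)
      finally show ?thesis .
    qed
    ultimately show ?thesis using a b by (simp add: dist_norm)
  qed
  have \<tau>_eq: "\<tau> (cp2_point a) (cp2_point b) = sheet b \<circ> slit (Z a) (Z b) \<circ> sheet a"
    if "a \<in> Y" "b \<in> Y" "a \<in> B" "b \<in> B" for a b
    using \<tau>_cp2_point near that by blast
  show "\<exists>U. open U \<and> p \<in> U \<and> (\<forall>y\<in>U \<inter> cp2_point ` Y. \<tau> y y = id) \<and>
      (\<forall>y\<in>U \<inter> cp2_point ` Y. \<forall>z\<in>U \<inter> cp2_point ` Y. \<forall>w\<in>U \<inter> cp2_point ` Y. \<tau> z w \<circ> \<tau> y z = \<tau> y w)"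
  proof (intro exI[of _ "cp2_point ` M"] conjI ballI U pU)
    fix y assume "y \<in> cp2_point ` M \<inter> cp2_point ` Y"
    then obtain a where a: "a \<in> Y" "a \<in> B" "y = cp2_point a" using rep by blast
    then show "\<tau> y y = id" using \<tau>_eq[of a a] by simp
  next
    fix y z w
    assume "y \<in> cp2_point ` M \<inter> cp2_point ` Y" "z \<in> cp2_point ` M \<inter> cp2_point ` Y"
      "w \<in> cp2_point ` M \<inter> cp2_point ` Y"
    then obtain a b c where abc: "a \<in> Y" "a \<in> B" "y = cp2_point a"
      "b \<in> Y" "b \<in> B" "z = cp2_point b" "c \<in> Y" "c \<in> B" "w = cp2_point c" using rep by metis
    have "\<tau> z w \<circ> \<tau> y z = sheet c \<circ> slit (Z b) (Z c) \<circ> (sheet b \<circ> sheet b) \<circ> slit (Z a) (Z b) \<circ> sheet a"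
      using abc by (simp only: \<tau>_eq o_assoc)
    also have "\<dots> = sheet c \<circ> (slit (Z b) (Z c) \<circ> slit (Z a) (Z b)) \<circ> sheet a"
      by (simp add: o_assoc)
    also have "\<dots> = \<tau> y w" using abc N(3)[of "Z a" "Z b" "Z c"] by (simp add: \<tau>_eq B_def)
    finally show "\<tau> z w \<circ> \<tau> y z = \<tau> y w" .
  qed
qed

text \<open>Reduces transport in the projective plane to the slit plane: along a continuous lift,
  nearby points stay on one local sheet, so \<open>\<tau>_cp2_point\<close> applies.\<close>

lemma flat_lift:
  fixes \<gamma> :: "'k::topological_space \<Rightarrow> complex^3"
  assumes \<gamma>: "continuous_on K \<gamma>" "\<gamma> ` K \<subseteq> Y" and k: "flat slit K (Z \<circ> \<gamma>) k"
  shows "flat \<tau> K (cp2_point \<circ> \<gamma>) (\<lambda>t. sheet (\<gamma> t) (k t))"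
  unfolding flat_def
proof
  fix t assume t: "t \<in> K"
  have tend: "(\<gamma> \<longlongrightarrow> \<gamma> t) (at t within K)" using \<gamma>(1) t by (simp add: continuous_on_def)
  have nz: "\<gamma> t \<noteq> 0" using \<gamma>(2) t Y_nonzero by blast
  have "((\<lambda>y. dist (\<gamma> t) (- \<gamma> y) - dist (\<gamma> t) (\<gamma> y)) \<longlongrightarrow> dist (\<gamma> t) (- \<gamma> t) - dist (\<gamma> t) (\<gamma> t)) (at t within K)"
    by (intro tendsto_intros tend)
  moreover have "dist (\<gamma> t) (- \<gamma> t) - dist (\<gamma> t) (\<gamma> t) > 0"
    using nz by (simp add: dist_norm flip: scaleR_2)
  ultimately have "\<forall>\<^sub>F y in at t within K. dist (\<gamma> t) (- \<gamma> y) - dist (\<gamma> t) (\<gamma> y) > 0"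
    by (rule order_tendstoD)
  moreover have "\<forall>\<^sub>F y in at t within K. y \<in> K" by (simp add: eventually_at_filter)
  moreover note flatD[OF k t]
  ultimately show "\<forall>\<^sub>F y in at t within K.
      sheet (\<gamma> y) (k y) = \<tau> ((cp2_point \<circ> \<gamma>) t) ((cp2_point \<circ> \<gamma>) y) (sheet (\<gamma> t) (k t))"
  proof eventually_elim
    case (elim y)
    then have "\<tau> (cp2_point (\<gamma> t)) (cp2_point (\<gamma> y)) = sheet (\<gamma> y) \<circ> slit (Z (\<gamma> t)) (Z (\<gamma> y)) \<circ> sheet (\<gamma> t)"
      using \<gamma>(2) t by (intro \<tau>_cp2_point) auto
    moreover have "sheet (\<gamma> t) (sheet (\<gamma> t) (k t)) = k t"
      using sheet_sheet[of "\<gamma> t"] by (metis comp_apply id_apply)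
    ultimately show ?case using elim(3) by simp
  qed
qed

end

section \<open>Normal form of bitangent conics\<close>

definition polar :: "(complex^3 \<Rightarrow> complex) \<Rightarrow> complex^3 \<Rightarrow> complex^3 \<Rightarrow> complex" where
  "polar q x y = q (x + y) - q x - q y"

lemma polar_commute: "polar q x y = polar q y x"
  by (simp add: polar_def add.commute)

context
  fixes K q
  assumes q: "quadratic_form_over K q"
begin

lemma polar_eq_gradient: "polar q x y = (\<Sum>i\<in>UNIV. gradient q x $ i * y $ i)"
proof -
  obtain A where A: "q = (\<lambda>x. \<Sum>i\<in>UNIV. \<Sum>j\<in>UNIV. A $ i $ j * x $ i * x $ j)"
    using q by (auto simp: quadratic_form_over_def)
  show ?thesis unfolding A gradient_quadratic_form polar_def
    by (simp add: sum_3 matrix_vector_mult_def transpose_def algebra_simps)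
qed

lemma quadratic_form_smult: "q (c *s x) = c\<^sup>2 * q x"
  using q by (auto simp: quadratic_form_over_def sum_distrib_left power2_eq_square ac_simps)

lemma quadratic_form_0: "q 0 = 0"
  using quadratic_form_smult[of 0 0] by simp

lemma continuous_on_quadratic_form: "continuous_on S q"
  using q by (auto simp: quadratic_form_over_def intro!: continuous_intros)

lemma polar_add_right: "polar q x (y + z) = polar q x y + polar q x z"
  by (simp add: polar_eq_gradient algebra_simps sum.distrib)

lemma polar_smult_right: "polar q x (c *s y) = c * polar q x y"
  by (simp add: polar_eq_gradient algebra_simps sum_distrib_left)

lemma polar_add_left: "polar q (y + z) x = polar q y x + polar q z x"
  using polar_add_right polar_commute by metis

lemma polar_smult_left: "polar q (c *s y) x = c * polar q y x"
  using polar_smult_right polar_commute by metis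

lemmas polar_linear = polar_add_left polar_add_right polar_smult_left polar_smult_right

lemma polar_self: "polar q x x = 2 * q x"
proof -
  have "x + x = 2 *s x" by (simp add: vec_eq_iff)
  then show ?thesis using quadratic_form_smult[of 2 x] by (simp only: polar_def) simp
qed

lemma quadratic_form_add: "q (x + y) = q x + q y + polar q x y"
  by (simp add: polar_def)

lemma quadratic_form_line: "q (x + t *s y) = poly [:q x, polar q x y, q y:] t"
  by (simp add: quadratic_form_add quadratic_form_smult polar_smult_right power2_eq_square algebra_simps)

text \<open>A vector in the radical is a zero of \<open>q\<close>, because
  \<open>polar q x x = 2 * q x\<close>, and its gradient vanishes; smoothness permits this only for
  the zero vector.\<close>

lemma polar_nondegenerate:
  assumes "smooth_curve q" "\<And>y. polar q x y = 0"
  shows "x = 0"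
proof (rule ccontr)
  assume "x \<noteq> 0"
  have "q x = 0" using assms(2)[of x] polar_self[of x] by simp
  then have "gradient q x \<noteq> 0" using assms(1) \<open>x \<noteq> 0\<close> by (auto simp: smooth_curve_def)
  then obtain i where "gradient q x $ i \<noteq> 0" by (auto simp: vec_eq_iff)
  moreover have "polar q x (axis i 1) = gradient q x $ i"
    unfolding polar_eq_gradient by (simp add: axis_def if_distrib cong: if_cong)
  ultimately show False using assms(2) by simp
qed

lemma cp2_point_mem_conic_iff: "v \<noteq> 0 \<Longrightarrow> cp2_point v \<in> curve q \<longleftrightarrow> q v = 0"
  by (rule cp2_point_mem_curve_iff) (simp_all add: quadratic_form_smult)

lemma cp2_point_mem_tangent_line_iff:
  assumes "u \<noteq> 0" "v \<noteq> 0"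
  shows "cp2_point v \<in> tangent_line q (cp2_point u) \<longleftrightarrow> polar q u v = 0"
proof
  assume "cp2_point v \<in> tangent_line q (cp2_point u)"
  then obtain x y where xy: "x \<noteq> 0" "y \<noteq> 0" "cp2_point u = cp2_point x" "cp2_point v = cp2_point y" "polar q x y = 0"
    unfolding tangent_line_def polar_eq_gradient by auto
  obtain c where c: "x = c *s u" using xy assms cp2_point_eq_iff by blast
  obtain d where d: "y = d *s v" using xy assms cp2_point_eq_iff by blast
  show "polar q u v = 0" using xy unfolding c d by (auto simp: polar_linear)
next
  assume "polar q u v = 0"
  then show "cp2_point v \<in> tangent_line q (cp2_point u)"
    using assms unfolding tangent_line_def polar_eq_gradient by blast
qed

end

text \<open>The matrix with columns \<open>u\<close>, \<open>w\<close>, 0 is not injective, hence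
  not surjective; any vector outside its range completes a basis.\<close>

lemma ex_basis_extension:
  fixes u w :: "complex^3"
  assumes indep: "\<And>x y. x *s u + y *s w = 0 \<Longrightarrow> x = 0 \<and> y = 0"
  obtains d where "\<And>v. \<exists>x y z. v = x *s u + y *s w + z *s d"
    "\<And>x y z. x *s u + y *s w + z *s d = 0 \<Longrightarrow> x = 0 \<and> y = 0 \<and> z = 0"
proof -
  define M :: "complex^3 \<Rightarrow> complex^3^3" where "M d = (\<chi> i j. if j = 1 then u $ i else if j = 2 then w $ i else d $ i)" for d
  have M: "M d *v x = x $ 1 *s u + x $ 2 *s w + x $ 3 *s d" for d x
    by (simp add: M_def matrix_vector_mult_def vec_eq_iff sum_3 mult.commute)
  have inj_surj: "inj ((*v) A) \<longleftrightarrow> surj ((*v) A)" for A :: "complex^3^3"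
    unfolding matrix_left_invertible_injective[symmetric] matrix_right_invertible_surjective[symmetric]
    using matrix_left_right_inverse by blast
  have "M 0 *v axis 3 1 = M 0 *v 0" by (simp add: M axis_def)
  moreover have "axis 3 1 \<noteq> (0 :: complex^3)" by (simp add: axis_eq_0_iff)
  ultimately have "\<not> surj ((*v) (M 0))" unfolding inj_surj[symmetric] by (metis injD)
  then obtain d where d: "d \<notin> range ((*v) (M 0))" by blast
  have indep3: "x = 0 \<and> y = 0 \<and> z = 0" if eq: "x *s u + y *s w + z *s d = 0" for x y z
  proof -
    have "z = 0"
    proof (rule ccontr)
      assume "z \<noteq> 0"
      have "d $ i = (- x / z) * u $ i + (- y / z) * w $ i" for i
      proof -
        have "x * u $ i + y * w $ i + z * d $ i = 0"
          using arg_cong[OF eq, of "\<lambda>v. v $ i"] by simp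
        then have "z * d $ i = - x * u $ i - y * w $ i" by (simp add: algebra_simps add_eq_0_iff)
        then show ?thesis using \<open>z \<noteq> 0\<close> by (simp add: field_simps)
      qed
      then have "d = M 0 *v vector [- x / z, - y / z, 0]" by (simp add: M vec_eq_iff)
      then show False using d by blast
    qed
    then show ?thesis using eq indep[of x y] by simp
  qed
  have "inj ((*v) (M d))"
    unfolding vec.inj_iff_eq_0
  proof (intro allI impI)
    fix x assume "M d *v x = 0"
    then show "x = 0" using indep3[of "x $ 1" "x $ 2" "x $ 3"] unfolding M by (simp add: vec_eq_iff forall_3)
  qed
  then have "surj ((*v) (M d))" unfolding inj_surj .
  then have "\<exists>x y z. v = x *s u + y *s w + z *s d" for v unfolding M surj_def by blast
  then show ?thesis using that indep3 by blast
qed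

text \<open>The tangent lines are the kernels of the polar functionals at \<open>u\<close>, and a
  functional vanishing on the kernel of a nonzero one is a multiple of it.\<close>

lemma polar_proportional_tangent:
  assumes q: "quadratic_form_over K q" "smooth_curve q" and q': "quadratic_form_over K' q'"
    and u: "u \<noteq> 0" and tan: "tangent_line q (cp2_point u) = tangent_line q' (cp2_point u)"
  obtains k where "\<And>v. polar q' u v = k * polar q u v"
proof -
  have iff: "polar q' u v = 0" if "polar q u v = 0" for v
  proof (cases "v = 0")
    case False
    then show ?thesis
      using that tan cp2_point_mem_tangent_line_iff[OF q(1) u False] cp2_point_mem_tangent_line_iff[OF q' u False]
      by simp
  next
    case True
    then show ?thesis using polar_smult_right[OF q', of u 0 0] by simp
  qed
  obtain y where y: "polar q u y \<noteq> 0" using polar_nondegenerate[OF q] u by blast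
  have "polar q' u v = polar q' u y / polar q u y * polar q u v" for v
  proof -
    let ?c = "- polar q u v / polar q u y"
    have "polar q u (v + ?c *s y) = polar q u v + ?c * polar q u y"
      by (simp only: polar_add_right[OF q(1)] polar_smult_right[OF q(1)])
    also have "\<dots> = 0" using y by simp
    finally have "polar q' u (v + ?c *s y) = 0" by (rule iff)
    then have "polar q' u v + ?c * polar q' u y = 0"
      by (simp only: polar_add_right[OF q'] polar_smult_right[OF q'])
    then show ?thesis by (simp add: add_eq_0_iff)
  qed
  then show ?thesis by (rule that)
qed

text \<open>Take \<open>u\<close> and \<open>w\<close> over the two tangency points and
  \<open>e\<close> over the pole of the line joining them. Common tangents make the polars at
  \<open>u\<close> and at \<open>w\<close> proportional, so both forms combine only
  \<open>x * y\<close> and \<open>z\<^sup>2\<close>. A multiple of one form therefore differs from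
  the other by a multiple of \<open>z\<^sup>2\<close>, nonzero because the curves differ, whose root
  is absorbed into \<open>e\<close>.\<close>

lemma tangent_conics_normal_form:
  assumes q1: "quadratic_form_over K q1" "smooth_curve q1"
    and q2: "quadratic_form_over K q2" "smooth_curve q2"
    and neq: "curve q1 \<noteq> curve q2"
    and PR: "tangent_at q1 q2 P" "tangent_at q1 q2 R" "P \<noteq> R"
  obtains u w e k \<gamma> Z where "u \<noteq> 0" "P = cp2_point u" "k \<noteq> 0"
    "\<And>x y z. q2 (x *s u + y *s w + z *s e) = k * (x * y + \<gamma> * z\<^sup>2)"
    "\<And>v. q1 v = q2 v / k + (Z v)\<^sup>2"
    "\<And>x y z. Z (x *s u + y *s w + z *s e) = z"
    "\<And>c v. Z (c *s v) = c * Z v" "continuous_on UNIV Z"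
    "\<And>v. \<exists>x y z. v = x *s u + y *s w + z *s e"
proof -
  obtain u where u: "u \<noteq> 0" "P = cp2_point u" by (rule cp2_point_cases)
  obtain w where w: "w \<noteq> 0" "R = cp2_point w" by (rule cp2_point_cases)
  have zero: "q1 u = 0" "q2 u = 0" "q1 w = 0" "q2 w = 0"
    using PR u w cp2_point_mem_conic_iff[OF q1(1)] cp2_point_mem_conic_iff[OF q2(1)]
    by (auto simp: tangent_at_def)
  have indep: "x = 0 \<and> y = 0" if eq: "x *s u + y *s w = 0" for x y
  proof -
    have "x = 0 \<longleftrightarrow> y = 0" using eq u w by auto
    moreover have "y = 0"
    proof (rule ccontr)
      assume "y \<noteq> 0"
      have "w $ i = (- x / y) * u $ i" for i
      proof -
        have "x * u $ i + y * w $ i = 0" using arg_cong[OF eq, of "\<lambda>v. v $ i"] by simp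
        then show ?thesis using \<open>y \<noteq> 0\<close> by (simp add: field_simps add_eq_0_iff)
      qed
      then have "w = (- x / y) *s u" by (simp add: vec_eq_iff)
      then have "P = R" using u w cp2_point_eq_iff by blast
      then show False using PR by simp
    qed
    ultimately show ?thesis by simp
  qed
  obtain d where d: "\<And>v. \<exists>x y z. v = x *s u + y *s w + z *s d"
    "\<And>x y z. x *s u + y *s w + z *s d = 0 \<Longrightarrow> x = 0 \<and> y = 0 \<and> z = 0"
    using ex_basis_extension[OF indep] by blast
  note lin1 = polar_linear[OF q1(1)] and lin2 = polar_linear[OF q2(1)]
  have self1: "polar q1 u u = 0" "polar q1 w w = 0"
    using polar_self[OF q1(1)] zero by simp_all
  define h where "h = polar q1 u w"
  have h': "polar q1 w u = h" unfolding h_def by (rule polar_commute)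
  have "h \<noteq> 0"
  proof
    assume h0: "h = 0"
    \<comment> \<open>With \<open>h = 0\<close> the span of \<open>u\<close> and \<open>w\<close> is
      isotropic; this combination is also orthogonal to \<open>d\<close> and so lies in the
      radical.\<close>
    let ?t = "polar q1 w d *s u + (- polar q1 u d) *s w"
    have "polar q1 ?t v = 0" for v
    proof -
      obtain x y z where v: "v = x *s u + y *s w + z *s d" using d(1) by blast
      show ?thesis unfolding v lin1 self1 h' h_def[symmetric] h0 by (simp add: mult.commute)
    qed
    then have "?t = 0" by (rule polar_nondegenerate[OF q1])
    then have "polar q1 u d = 0" using indep by fastforce
    then have "polar q1 u v = 0" for v
    proof -
      obtain x y z where v: "v = x *s u + y *s w + z *s d" using d(1) by blast
      show ?thesis unfolding v lin1 self1 h_def[symmetric] h0 \<open>polar q1 u d = 0\<close> by simp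
    qed
    then have "u = 0" by (rule polar_nondegenerate[OF q1])
    then show False using u by simp
  qed
  \<comment> \<open>The projection of \<open>d\<close> to the orthogonal complement of the
    hyperbolic pair \<open>u\<close>, \<open>w\<close>.\<close>
  define e where "e = d + (- polar q1 w d / h) *s u + (- polar q1 u d / h) *s w"
  have pe1: "polar q1 u e = 0" "polar q1 w e = 0"
    unfolding e_def lin1 self1 h' h_def[symmetric] using \<open>h \<noteq> 0\<close> by simp_all
  then have pe1': "polar q1 e u = 0" "polar q1 e w = 0"
    by (simp_all add: polar_commute[of q1 e u] polar_commute[of q1 e w])
  have span: "\<exists>x y z. v = x *s u + y *s w + z *s e" for v
  proof -
    obtain x y z where v: "v = x *s u + y *s w + z *s d" using d(1) by blast
    have "v = (x + z * (polar q1 w d / h)) *s u + (y + z * (polar q1 u d / h)) *s w + z *s e"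
      unfolding v e_def by (simp add: vec_eq_iff algebra_simps)
    then show ?thesis by blast
  qed
  have "e \<noteq> 0"
  proof
    assume "e = 0"
    then have "(- polar q1 w d / h) *s u + (- polar q1 u d / h) *s w + 1 *s d = 0"
      by (simp add: e_def algebra_simps)
    from d(2)[OF this] show False by simp
  qed
  have "q1 e \<noteq> 0"
  proof
    assume "q1 e = 0"
    then have "polar q1 e e = 0" using polar_self[OF q1(1)] by simp
    then have "polar q1 e v = 0" for v
    proof -
      obtain x y z where v: "v = x *s u + y *s w + z *s e" using span by blast
      show ?thesis unfolding v lin1 using pe1' \<open>polar q1 e e = 0\<close> by simp
    qed
    then have "e = 0" by (rule polar_nondegenerate[OF q1])
    then show False using \<open>e \<noteq> 0\<close> by simp
  qed
  obtain k where k: "\<And>v. polar q2 u v = k * polar q1 u v"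
    using polar_proportional_tangent[OF q1 q2(1) u(1)] PR(1) u(2) by (auto simp: tangent_at_def)
  obtain k' where k': "\<And>v. polar q2 w v = k' * polar q1 w v"
    using polar_proportional_tangent[OF q1 q2(1) w(1)] PR(2) w(2) by (auto simp: tangent_at_def)
  have "k \<noteq> 0" using polar_nondegenerate[OF q2, of u] k u by auto
  have pe2: "polar q2 u w = k * h" "polar q2 u e = 0" "polar q2 w e = 0"
    using k k' pe1 by (simp_all add: h_def)
  have f1: "q1 (x *s u + y *s w + z *s e) = x * y * h + z\<^sup>2 * q1 e" for x y z
    by (simp add: quadratic_form_add[OF q1(1)] quadratic_form_smult[OF q1(1)] lin1 zero pe1 h_def)
  have f2: "q2 (x *s u + y *s w + z *s e) = k * (x * y * h) + z\<^sup>2 * q2 e" for x y z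
    by (simp add: quadratic_form_add[OF q2(1)] quadratic_form_smult[OF q2(1)] lin2 zero pe2)
  define \<delta> where "\<delta> = q1 e - q2 e / k"
  have "\<delta> \<noteq> 0"
  proof
    assume "\<delta> = 0"
    then have e2: "q2 e = k * q1 e" using \<open>k \<noteq> 0\<close> by (simp add: \<delta>_def field_simps)
    have "q2 v = k * q1 v" for v
    proof -
      obtain x y z where v: "v = x *s u + y *s w + z *s e" using span by blast
      show ?thesis unfolding v f1 f2 e2 by (simp add: algebra_simps)
    qed
    then have "curve q1 = curve q2" using \<open>k \<noteq> 0\<close> by (simp add: curve_def)
    then show False using neq by simp
  qed
  define r where "r = csqrt \<delta>"
  have r: "r\<^sup>2 = \<delta>" "r \<noteq> 0" using \<open>\<delta> \<noteq> 0\<close> by (simp_all add: r_def)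
  \<comment> \<open>The polar with \<open>e\<close> kills \<open>u\<close> and \<open>w\<close> and
    equals \<open>2 * q1 e\<close> on \<open>e\<close>, so this is \<open>r\<close> times the
    \<open>e\<close>-coordinate.\<close>
  define Z where "Z v = r * polar q1 e v / (2 * q1 e)" for v
  let ?u = "(1 / h) *s u" and ?e = "(1 / r) *s e"
  have scaled: "x *s ?u + y *s w + z *s ?e = (x / h) *s u + y *s w + (z / r) *s e" for x y z
    by simp
  have Z: "Z (x *s u + y *s w + z *s e) = r * z" for x y z
    unfolding Z_def lin1 using pe1' polar_self[OF q1(1), of e] \<open>q1 e \<noteq> 0\<close> by simp
  show ?thesis
  \<comment> \<open>Dividing \<open>u\<close> by \<open>h\<close> normalizes the coefficient of
    \<open>x * y\<close>; dividing \<open>e\<close> by \<open>r\<close> turns \<open>Z\<close> into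
    the third coordinate and \<open>q2 e\<close> into \<open>q2 e / \<delta>\<close>.\<close>
  proof (rule that[of ?u k w ?e "q2 e / (k * \<delta>)" Z])
    show "?u \<noteq> 0" using u \<open>h \<noteq> 0\<close> by simp
    show "P = cp2_point ?u" unfolding u(2) using u \<open>h \<noteq> 0\<close> by (simp add: cp2_point_smult)
    show "k \<noteq> 0" by fact
    show "q2 (x *s ?u + y *s w + z *s ?e) = k * (x * y + q2 e / (k * \<delta>) * z\<^sup>2)" for x y z
      unfolding scaled f2 using \<open>h \<noteq> 0\<close> \<open>k \<noteq> 0\<close> \<open>\<delta> \<noteq> 0\<close> r
      by (simp add: power_divide field_simps)
    show "q1 v = q2 v / k + (Z v)\<^sup>2" for v
    proof -
      obtain x y z where v: "v = x *s u + y *s w + z *s e" using span by blast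
      show ?thesis unfolding v f1 f2 Z power_mult_distrib r(1) \<delta>_def using \<open>k \<noteq> 0\<close>
        by (simp add: field_simps)
    qed
    show "Z (x *s ?u + y *s w + z *s ?e) = z" for x y z
      unfolding scaled Z using r by simp
    show "Z (c *s v) = c * Z v" for c v by (simp add: Z_def lin1)
    show "continuous_on UNIV Z"
      unfolding Z_def polar_def
      by (intro continuous_intros continuous_on_compose2[OF continuous_on_quadratic_form[OF q1(1), of UNIV]])
        (use \<open>q1 e \<noteq> 0\<close> in auto)
    show "\<exists>x y z. v = x *s ?u + y *s w + z *s ?e" for v
    proof -
      obtain x y z where v: "v = x *s u + y *s w + z *s e" using span by blast
      have "v = (x * h) *s ?u + y *s w + (z * r) *s ?e"
        unfolding scaled v using \<open>h \<noteq> 0\<close> r by simp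
      then show ?thesis by blast
    qed
  qed
qed

section \<open>Monodromy\<close>

text \<open>Such a map meets the imaginary axis only on the slit above \<open>\<i>\<close>, so
  \<open>side\<close> alone records the shears.\<close>

lemma flat_slit_upper:
  fixes s :: "'k::topological_space \<Rightarrow> complex"
  assumes s: "continuous_on K s" and region: "\<And>t. t \<in> K \<Longrightarrow> Re (s t) \<noteq> 0 \<or> Im (s t) > 1"
  shows "flat slit K s (\<lambda>t. shear (side (s t)) m)"
  unfolding flat_def
proof
  fix t assume t: "t \<in> K"
  have tends: "(s \<longlongrightarrow> s t) (at t within K)" using s t by (simp add: continuous_on_def)
  note Re = tendsto_Re[OF tends] and Im = tendsto_Im[OF tends]
  consider "Re (s t) > 0" | "Re (s t) < 0" | "Im (s t) > 1" using region[OF t] by linarith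
  then show "\<forall>\<^sub>F y in at t within K. shear (side (s y)) m = slit (s t) (s y) (shear (side (s t)) m)"
  proof cases
    case 1
    from order_tendstoD(1)[OF Re this] show ?thesis
      by eventually_elim (use 1 in \<open>simp add: slit_right, simp add: side_def\<close>)
  next
    case 2
    from order_tendstoD(2)[OF Re this] show ?thesis
      by eventually_elim (use 2 in \<open>simp add: slit_left, simp add: side_def\<close>)
  next
    case 3
    have comp: "shear a (shear b m) = shear (a + b) m" for a b
      using shear_comp_shear by (metis comp_apply)
    from order_tendstoD(1)[OF Im 3] show ?thesis
      by eventually_elim (use 3 in \<open>simp add: slit_upper comp\<close>)
  qed
qed

lemma flat_slit_middle:
  fixes s :: "'k::topological_space \<Rightarrow> complex"
  assumes "\<And>t. t \<in> K \<Longrightarrow> \<bar>Im (s t)\<bar> < 1"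
  shows "flat slit K s (\<lambda>_. m)"
  unfolding flat_def using assms by (simp add: slit_middle)

text \<open>With \<open>a = 2\<close> the arc crosses the imaginary axis at \<open>2 * \<i>\<close>,
  above \<open>\<i>\<close>; with \<open>a = - 1 / 2\<close> at \<open>- \<i> / 2\<close>, between
  the two punctures.\<close>

definition half_ellipse :: "real \<Rightarrow> real \<Rightarrow> complex" where
  "half_ellipse a t = Complex (cos (pi * t)) (a * sin (pi * t))"

lemma continuous_on_half_ellipse: "continuous_on S (half_ellipse a)"
  unfolding half_ellipse_def by (intro continuous_intros)

lemma half_ellipse_ends [simp]: "half_ellipse a 0 = 1" "half_ellipse a 1 = - 1"
  by (simp_all add: half_ellipse_def complex_eq_iff)

text \<open>The squared modulus is a convex combination of 1 and \<open>a\<^sup>2\<close>. On the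
  imaginary axis the modulus is \<open>\<bar>a\<bar>\<close>, different from 1, so the punctures are
  avoided.\<close>

lemma half_ellipse_bounds:
  assumes "a = 2 \<or> a = - 1 / 2"
  shows "1 / 2 \<le> cmod (half_ellipse a t)" "cmod (half_ellipse a t) \<le> 2" "1 + (half_ellipse a t)\<^sup>2 \<noteq> 0"
proof -
  let ?s = "half_ellipse a t"
  have cs: "(sin (pi * t))\<^sup>2 + (cos (pi * t))\<^sup>2 = 1" by simp
  have n: "(cmod ?s)\<^sup>2 = (cos (pi * t))\<^sup>2 + a\<^sup>2 * (sin (pi * t))\<^sup>2"
    by (simp add: half_ellipse_def cmod_power2 power_mult_distrib)
  have a: "a\<^sup>2 = 4 \<or> a\<^sup>2 = 1 / 4" using assms by (auto simp: power2_eq_square)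
  have "1 / 4 \<le> c + A * d \<and> c + A * d \<le> 4"
    if "A = 4 \<or> A = 1 / 4" "d + c = 1" "c \<ge> 0" "d \<ge> 0" for A c d :: real
    using that(1)
  proof
    assume A: "A = 4"
    show ?thesis unfolding A using that(2-4) by linarith
  next
    assume A: "A = 1 / 4"
    show ?thesis unfolding A using that(2-4) by linarith
  qed
  from this[OF a cs] have sq: "1 / 4 \<le> (cmod ?s)\<^sup>2" "(cmod ?s)\<^sup>2 \<le> 4"
    unfolding n by simp_all
  show "1 / 2 \<le> cmod ?s" by (rule power2_le_imp_le) (use sq in \<open>simp_all add: power_divide\<close>)
  show "cmod ?s \<le> 2" by (rule power2_le_imp_le) (use sq in simp_all)
  show "1 + ?s\<^sup>2 \<noteq> 0"
  proof
    assume "1 + ?s\<^sup>2 = 0"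
    then have "?s = \<i> \<or> ?s = - \<i>"
      by (metis add.commute add_eq_0_iff power2_eq_iff power2_i)
    then have "cos (pi * t) = 0" "(a * sin (pi * t))\<^sup>2 = 1"
      by (auto simp: half_ellipse_def complex_eq_iff power2_eq_square)
    then show False using a cs by (auto simp: power_mult_distrib)
  qed
qed

section \<open>Monodromy of loops carried by a section over the annulus\<close>

context conic_pencil
begin

text \<open>Oddness of \<open>V\<close> closes the image of each half-ellipse to a loop. Upper arc
  then lower arc lifts to the circuit \<open>1\<close>, \<open>2 * \<i>\<close>, \<open>- 1\<close>,
  \<open>\<i> / 2\<close>, \<open>1\<close> around \<open>\<i>\<close>; the other order lifts to a
  circuit around \<open>- \<i>\<close>.\<close>

lemma big_group_conic_pencil:
  assumes X: "path_connected X" "X \<subseteq> cp2_point ` Y" "b \<in> X"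
    and V: "continuous_on (- {0}) V" "\<And>s. s \<noteq> 0 \<Longrightarrow> Q (V s) = 1" "\<And>s. Z (V s) = s" "\<And>s. V (- s) = - V s"
    and V_X: "\<And>s. 1 / 2 \<le> cmod s \<Longrightarrow> cmod s \<le> 2 \<Longrightarrow> 1 + s\<^sup>2 \<noteq> 0 \<Longrightarrow> cp2_point (V s) \<in> X"
  shows "big_group (fundamental_group X b)"
proof -
  define P where "P = (\<lambda>s. cp2_point (V s))"
  have V_Y: "V s \<in> Y" if "s \<noteq> 0" "1 + s\<^sup>2 \<noteq> 0" for s
    using that V by (simp add: Y_def)
  define \<alpha> where "\<alpha> a = P \<circ> half_ellipse a" for a
  have a: "half_ellipse a t \<noteq> 0" "V (half_ellipse a t) \<in> Y" "P (half_ellipse a t) \<in> X"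
    if "a = 2 \<or> a = - 1 / 2" for a t
  proof -
    note bounds = half_ellipse_bounds[OF that, of t]
    show nz: "half_ellipse a t \<noteq> 0" using bounds(1) by auto
    show "V (half_ellipse a t) \<in> Y" using V_Y nz bounds by blast
    show "P (half_ellipse a t) \<in> X" unfolding P_def using V_X bounds by blast
  qed
  have cont: "continuous_on {0..1} (V \<circ> half_ellipse a)" if "a = 2 \<or> a = - 1 / 2" for a
    by (intro continuous_on_compose continuous_on_half_ellipse continuous_on_subset[OF V(1)])
      (use a[OF that] in auto)
  have \<alpha>_path: "path (\<alpha> a)" "path_image (\<alpha> a) \<subseteq> X" if "a = 2 \<or> a = - 1 / 2" for a
  proof -
    have "continuous_on {0..1} (cp2_point \<circ> (V \<circ> half_ellipse a))"
      by (intro continuous_on_compose cont[OF that] continuous_on_subset[OF continuous_on_cp2_point])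
        (use a(2)[OF that] Y_nonzero in auto)
    then show "path (\<alpha> a)" by (simp add: path_def \<alpha>_def P_def comp_def)
    show "path_image (\<alpha> a) \<subseteq> X" using a(3)[OF that] by (auto simp: path_image_def \<alpha>_def)
  qed
  have V1: "V 1 \<in> Y" using V_Y[of 1] by simp
  have P_minus: "P (- 1) = P 1"
    unfolding P_def V(4)[of 1] by (rule cp2_point_uminus[OF Y_nonzero[OF V1]])
  have ends: "pathstart (\<alpha> a) = P 1" "pathfinish (\<alpha> a) = P 1" for a
    using P_minus by (simp_all add: pathstart_def pathfinish_def \<alpha>_def)
  define S where "S = sheet (V 1)"
  have SS: "S (S m) = m" for m unfolding S_def using sheet_sheet[of "V 1"] by (metis comp_apply id_apply)
  have S_minus: "sheet (V (- 1)) = prod.swap \<circ> S"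
    unfolding V(4)[of 1] S_def by (rule sheet_uminus[OF V1])
  have XY: "path_image g \<subseteq> cp2_point ` Y" if "path_image g \<subseteq> X" for g using that X(2) by blast
  \<comment> \<open>The lift ends at \<open>V (- 1) = - V 1\<close>, on the other sheet; reading the
    value there costs one exchange of coordinates.\<close>
  have tr: "transport (\<alpha> a) m = prod.swap (S (k 1))"
    if a2: "a = 2 \<or> a = - 1 / 2" and k: "flat slit {0..1} (half_ellipse a) k" "k 0 = S m" for a m k
  proof (rule transport_eqI[OF \<alpha>_path(1)[OF a2] XY[OF \<alpha>_path(2)[OF a2]]])
    have "flat slit {0..1} (Z \<circ> (V \<circ> half_ellipse a)) k"
      using k(1) by (simp add: comp_def V(3))
    then have "flat \<tau> {0..1} (cp2_point \<circ> (V \<circ> half_ellipse a)) (\<lambda>t. sheet ((V \<circ> half_ellipse a) t) (k t))"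
      by (intro flat_lift cont[OF a2]) (use a(2)[OF a2] in auto)
    then show "flat \<tau> {0..1} (\<alpha> a) (\<lambda>t. sheet (V (half_ellipse a t)) (k t))"
      by (simp add: \<alpha>_def P_def comp_def)
    show "sheet (V (half_ellipse a 0)) (k 0) = m" using k(2) SS by (simp add: S_def)
    show "sheet (V (half_ellipse a 1)) (k 1) = prod.swap (S (k 1))" by (simp add: S_minus)
  qed
  have tr_A: "transport (\<alpha> 2) m = prod.swap (S (shear 1 (S m)))" for m
  proof -
    have "Re (half_ellipse 2 t) \<noteq> 0 \<or> Im (half_ellipse 2 t) > 1" if "t \<in> {0..1}" for t
    proof -
      have "sin (pi * t) \<ge> 0" using that by (intro sin_ge_zero) (auto simp: mult_le_cancel_left1)
      moreover have "sin (pi * t) = 1" if "cos (pi * t) = 0" "sin (pi * t) \<ge> 0"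
        using that sin_cos_squared_add[of "pi * t"] by (simp add: power2_eq_1_iff)
      ultimately show ?thesis by (auto simp: half_ellipse_def)
    qed
    then have "flat slit {0..1} (half_ellipse 2) (\<lambda>t. shear (side (half_ellipse 2 t)) (S m))"
      by (intro flat_slit_upper continuous_on_half_ellipse)
    from tr[OF _ this] show ?thesis by (simp add: side_def)
  qed
  have tr_D: "transport (\<alpha> (- 1 / 2)) m = prod.swap m" for m
  proof -
    have "\<bar>Im (half_ellipse (- 1 / 2) t)\<bar> < 1" for t
    proof -
      have "\<bar>Im (half_ellipse (- 1 / 2) t)\<bar> = \<bar>sin (pi * t)\<bar> / 2" by (simp add: half_ellipse_def)
      then show ?thesis using abs_sin_le_one[of "pi * t"] by linarith
    qed
    then have "flat slit {0..1} (half_ellipse (- 1 / 2)) (\<lambda>_. S m)"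
      by (intro flat_slit_middle)
    from tr[OF _ this] show ?thesis by (simp add: SS)
  qed
  let ?A = "\<alpha> 2" and ?D = "\<alpha> (- 1 / 2)"
  have swap_S: "prod.swap (S m) = S (prod.swap m)" for m by (simp add: S_def sheet_def)
  have P1: "P 1 \<in> X" using a(3)[of 2 0] by simp
  obtain \<kappa> where \<kappa>: "path \<kappa>" "path_image \<kappa> \<subseteq> X" "pathstart \<kappa> = b" "pathfinish \<kappa> = P 1"
    using X(1,3) P1 unfolding path_connected_def by blast
  let ?\<kappa>' = "reversepath \<kappa>"
  have \<kappa>': "path ?\<kappa>'" "path_image ?\<kappa>' \<subseteq> X" using \<kappa> by simp_all
  have inv1: "transport ?\<kappa>' (transport \<kappa> m) = m" and inv2: "transport \<kappa> (transport ?\<kappa>' m) = m" for m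
    using transport_reversepath[OF \<kappa>(1) XY[OF \<kappa>(2)]] transport_reversepath[OF \<kappa>'(1) XY[OF \<kappa>'(2)]]
    by simp_all
  let ?G = "fundamental_group X b" and ?R = "loop_homotopy X b"
  interpret G: group ?G using X(3) by (rule group_fundamental_group)
  have carrier: "carrier ?G = (\<lambda>p. ?R `` {p}) ` loops X b"
    by (auto simp: fundamental_group_def quotient_def)
  \<comment> \<open>The action of loops at \<open>b\<close>, carried along \<open>\<kappa>\<close>
    to the fibre at \<open>P 1\<close> and expressed through \<open>S\<close> on the sheet of
    \<open>V 1\<close>. Homotopy invariance makes the choice of a representative harmless.\<close>
  define \<phi> where "\<phi> g m = S (transport \<kappa> (transport (SOME p. p \<in> g) (transport ?\<kappa>' (S m))))" for g m
  have \<phi>: "\<phi> (?R `` {p}) m = S (transport \<kappa> (transport p (transport ?\<kappa>' (S m))))" if p: "p \<in> loops X b" for p m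
  proof -
    have "p \<in> ?R `` {p}" using p equiv_loop_homotopy[of X b] by (auto simp: equiv_def refl_on_def)
    then have "(SOME q. q \<in> ?R `` {p}) \<in> ?R `` {p}" by (rule someI[where P = "\<lambda>q. q \<in> ?R `` {p}"])
    moreover have "homotopic_paths X p q" if "q \<in> ?R `` {p}" for q
      using that by (simp add: loop_homotopy_def)
    ultimately have "homotopic_paths X p (SOME q. q \<in> ?R `` {p})" by blast
    then show ?thesis unfolding \<phi>_def using transport_homotopic[OF _ X(2)] by metis
  qed
  have loopsD: "path p" "path_image p \<subseteq> cp2_point ` Y" "pathstart p = b" "pathfinish p = b" if "p \<in> loops X b" for p
    using that X(2) by (auto simp: loops_def)
  have const: "(\<lambda>_. b) \<in> loops X b"
    using X(3) by (auto simp: loops_def path_def path_image_def pathstart_def pathfinish_def)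
  have loop: "\<kappa> +++ ((\<alpha> a +++ \<alpha> a') +++ ?\<kappa>') \<in> loops X b"
    and tr_loop: "transport (\<kappa> +++ ((\<alpha> a +++ \<alpha> a') +++ ?\<kappa>')) m =
      transport ?\<kappa>' (transport (\<alpha> a') (transport (\<alpha> a) (transport \<kappa> m)))"
    if aa: "a = 2 \<or> a = - 1 / 2" "a' = 2 \<or> a' = - 1 / 2" for a a' m
  proof -
    note p = \<alpha>_path[OF aa(1)] and p' = \<alpha>_path[OF aa(2)]
    have q: "path (\<alpha> a +++ \<alpha> a')" "path_image (\<alpha> a +++ \<alpha> a') \<subseteq> X"
      using p p' ends by (simp_all add: path_image_join)
    have q': "path ((\<alpha> a +++ \<alpha> a') +++ ?\<kappa>')" "path_image ((\<alpha> a +++ \<alpha> a') +++ ?\<kappa>') \<subseteq> X"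
      using q \<kappa> \<kappa>' ends by (simp_all add: path_image_join)
    show "\<kappa> +++ ((\<alpha> a +++ \<alpha> a') +++ ?\<kappa>') \<in> loops X b"
      using q' \<kappa> ends by (simp add: loops_def path_image_join)
    show "transport (\<kappa> +++ ((\<alpha> a +++ \<alpha> a') +++ ?\<kappa>')) m =
      transport ?\<kappa>' (transport (\<alpha> a') (transport (\<alpha> a) (transport \<kappa> m)))"
      using p p' q q' \<kappa> \<kappa>' ends XY by (simp add: transport_join)
  qed
  let ?x = "?R `` {\<kappa> +++ ((?A +++ ?D) +++ ?\<kappa>')}" and ?y = "?R `` {\<kappa> +++ ((?D +++ ?A) +++ ?\<kappa>')}"
  show ?thesis
  proof (rule G.big_group_shears[where x = ?x and y = ?y and \<phi> = \<phi>])
    show "?x \<in> carrier ?G" "?y \<in> carrier ?G" unfolding carrier using loop by blast+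
    have "\<one>\<^bsub>?G\<^esub> = ?R `` {\<lambda>_. b}" by (simp add: fundamental_group_def)
    moreover have "transport (\<lambda>_. b) m = m" for m using transport_const X by blast
    ultimately show "\<phi> \<one>\<^bsub>?G\<^esub> = id" using \<phi>[OF const] by (auto simp: fun_eq_iff inv2 SS)
  next
    fix g h assume "g \<in> carrier ?G" "h \<in> carrier ?G"
    then obtain p q where pq: "p \<in> loops X b" "q \<in> loops X b" "g = ?R `` {p}" "h = ?R `` {q}"
      unfolding carrier by blast
    show "\<phi> (g \<otimes>\<^bsub>?G\<^esub> h) = \<phi> h \<circ> \<phi> g"
      unfolding pq(3,4) fundamental_group_mult[OF pq(1,2)]
      using pq(1,2) loopsD[OF pq(1)] loopsD[OF pq(2)]
      by (simp add: fun_eq_iff \<phi> loops_join transport_join inv1 SS)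
  next
    show "\<phi> ?x = shear 1" "\<phi> ?y = prod.swap \<circ> shear 1 \<circ> prod.swap"
      by (simp_all add: fun_eq_iff \<phi> loop tr_loop inv2 tr_A tr_D[simplified] SS swap_S)
  qed
qed

end

section \<open>Arrangements of conics and lines\<close>

lemma linear_form_smult: "linear_form_over K l \<Longrightarrow> l (c *s x) = c * l x"
  by (auto simp: linear_form_over_def sum_distrib_left ac_simps)

lemma linear_form_add: "linear_form_over K l \<Longrightarrow> l (x + y) = l x + l y"
  by (auto simp: linear_form_over_def distrib_left sum.distrib)

text \<open>The points with \<open>q\<^sub>2 = k\<close> on a line through the tangency point \<open>w\<close>; the parameter \<open>x\<close>
  selects the line and \<open>s\<close> is the value of the linear form \<open>Z\<close>.\<close>

definition pencil_section :: "complex^3 \<Rightarrow> complex^3 \<Rightarrow> complex^3 \<Rightarrow> complex \<Rightarrow> real \<Rightarrow> complex \<Rightarrow> complex^3" where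
  "pencil_section u w e \<gamma> x s = (s * of_real x) *s u + ((1 / s - \<gamma> * s) / of_real x) *s w + s *s e"

text \<open>On the section \<open>l\<close> is \<open>s\<close> times
  \<open>x * l u + l e + (1 / s\<^sup>2 - \<gamma>) * l w / x\<close>. For large \<open>x\<close>
  the last term is small uniformly on the annulus, while the rest is the nonzero constant
  \<open>l e\<close> or grows with \<open>x\<close>.\<close>

lemma eventually_line_avoids_section:
  assumes l: "linear_form_over K l" and ue: "l u \<noteq> 0 \<or> l e \<noteq> 0"
  shows "\<forall>\<^sub>F x in at_top. \<forall>s. 1 / 2 \<le> cmod s \<longrightarrow> cmod s \<le> 2 \<longrightarrow> l (pencil_section u w e \<gamma> x s) \<noteq> 0"
proof -
  \<comment> \<open>The 4 bounds \<open>1 / s\<^sup>2\<close> for \<open>cmod s\<close> at least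
    1/2.\<close>
  define C where "C = cmod (l w) * (4 + cmod \<gamma>)"
  have "((\<lambda>x::real. C / x) \<longlongrightarrow> 0) at_top"
    by (intro tendsto_divide_0[OF tendsto_const] filterlim_at_top_imp_at_infinity filterlim_ident)
  then have small: "\<forall>\<^sub>F x in at_top. C / x < \<epsilon>" if "\<epsilon> > 0" for \<epsilon>
    using that by (rule order_tendstoD)
  have far: "\<forall>\<^sub>F x::real in at_top. C / x < cmod (of_real x * l u + l e)"
  proof (cases "l u = 0")
    case True
    then show ?thesis using small[of "cmod (l e)"] ue by simp
  next
    case False
    have "\<forall>\<^sub>F x::real in at_top. (1 + cmod (l e)) / cmod (l u) < x" by (rule eventually_gt_at_top)
    with small[of 1, simplified] eventually_gt_at_top[of "0::real"] show ?thesis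
    proof eventually_elim
      case (elim x)
      have "cmod (of_real x * l u) \<le> cmod (of_real x * l u + l e) + cmod (l e)"
        using norm_triangle_ineq4[of "of_real x * l u + l e" "l e"] by simp
      moreover have "1 + cmod (l e) < cmod (of_real x * l u)"
        using elim False by (simp add: norm_mult field_simps)
      ultimately show ?case using elim(1) by linarith
    qed
  qed
  from far eventually_gt_at_top[of "0::real"] show ?thesis
  proof eventually_elim
    case (elim x)
    show ?case
    proof (intro allI impI notI)
      fix s assume s: "1 / 2 \<le> cmod s" "cmod s \<le> 2" and zero: "l (pencil_section u w e \<gamma> x s) = 0"
      have nz: "s \<noteq> 0" using s by auto
      have "l (pencil_section u w e \<gamma> x s) =
          s * (of_real x * l u + l e + (1 / s\<^sup>2 - \<gamma>) * l w / of_real x)"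
        using nz elim(2) unfolding pencil_section_def linear_form_add[OF l] linear_form_smult[OF l]
        by (simp add: field_simps power2_eq_square)
      then have "of_real x * l u + l e = - ((1 / s\<^sup>2 - \<gamma>) * l w / of_real x)"
        using zero nz by (simp add: add_eq_0_iff2)
      then have "cmod (of_real x * l u + l e) = cmod (1 / s\<^sup>2 - \<gamma>) * cmod (l w) / x"
        using elim(2) by (simp add: norm_mult norm_divide)
      also have "\<dots> \<le> (4 + cmod \<gamma>) * cmod (l w) / x"
      proof (intro divide_right_mono mult_right_mono)
        have "1 / cmod s \<le> 2" using s nz by (simp add: field_simps)
        then have "(1 / cmod s)\<^sup>2 \<le> 2\<^sup>2" by (intro power_mono) auto
        then have "cmod (1 / s\<^sup>2) \<le> 4" by (simp add: norm_divide norm_power power_divide)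
        then show "cmod (1 / s\<^sup>2 - \<gamma>) \<le> 4 + cmod \<gamma>"
          using norm_triangle_ineq4[of "1 / s\<^sup>2" \<gamma>] by linarith
      qed (use elim in auto)
      also have "\<dots> = C / x" by (simp add: C_def mult.commute)
      finally show False using elim(1) by simp
    qed
  qed
qed

theorem big_group_tangent_conics_and_lines:
  assumes q1: "quadratic_form_over K q1" "smooth_curve q1"
    and q2: "quadratic_form_over K q2" "smooth_curve q2"
    and neq: "curve q1 \<noteq> curve q2"
    and PR: "tangent_at q1 q2 P" "tangent_at q1 q2 R" "P \<noteq> R"
    and \<L>: "finite \<L>" "\<And>l. l \<in> \<L> \<Longrightarrow> linear_form_over K l \<and> l \<noteq> (\<lambda>x. 0)"
    and tan: "\<And>l. l \<in> \<L> \<Longrightarrow> \<not> (tangent_at q1 l P \<and> tangent_at q2 l P)"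
    and T: "T = curve q1 \<union> curve q2 \<union> (\<Union>l\<in>\<L>. curve l)" and b: "b \<in> - T"
  shows "big_group (fundamental_group (- T) b)"
proof -
  obtain u w e k \<gamma> Z where u: "u \<noteq> 0" "P = cp2_point u" and k: "k \<noteq> 0"
    and q2_eq: "\<And>x y z. q2 (x *s u + y *s w + z *s e) = k * (x * y + \<gamma> * z\<^sup>2)"
    and q1_eq: "\<And>v. q1 v = q2 v / k + (Z v)\<^sup>2"
    and Z_eq: "\<And>x y z. Z (x *s u + y *s w + z *s e) = z"
    and Z: "\<And>c v. Z (c *s v) = c * Z v" "continuous_on UNIV Z"
    and span: "\<And>v. \<exists>x y z. v = x *s u + y *s w + z *s e"
    by (rule tangent_conics_normal_form[OF q1 q2 neq PR]) (rule that; assumption)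
  define Q where "Q v = q2 v / k" for v
  interpret conic_pencil Q Z
  proof
    show "continuous_on UNIV Q"
      unfolding Q_def using k by (intro continuous_intros continuous_on_quadratic_form[OF q2(1)]) auto
  qed (simp_all add: Q_def quadratic_form_smult[OF q2(1)] Z)
  \<comment> \<open>A line form vanishing at \<open>u\<close> and \<open>e\<close> is a multiple of
    the coordinate \<open>y\<close>, which is the polar of \<open>q1\<close> at \<open>u\<close>;
    the line would be the common tangent at \<open>P\<close>.\<close>
  have l_ue: "l u \<noteq> 0 \<or> l e \<noteq> 0" if l: "l \<in> \<L>" for l
  proof (rule ccontr)
    assume "\<not> ?thesis"
    then have 0: "l u = 0" "l e = 0" by auto
    have form: "linear_form_over K l" using \<L>(2)[OF l] by simp
    have l_eq: "l (x *s u + y *s w + z *s e) = y * l w" for x y z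
      by (simp add: linear_form_smult[OF form] linear_form_add[OF form] 0)
    have "l w \<noteq> 0"
    proof
      assume "l w = 0"
      then have "l v = 0" for v using span[of v] l_eq by force
      then show False using \<L>(2)[OF l] by auto
    qed
    have polar: "polar q1 u (x *s u + y *s w + z *s e) = y" for x y z
    proof -
      have "u + (x *s u + y *s w + z *s e) = (1 + x) *s u + y *s w + z *s e"
        and "u = 1 *s u + 0 *s w + 0 *s e" by (simp_all add: algebra_simps)
      then show ?thesis using q2_eq[of "1 + x" y z] q2_eq[of 1 0 0] q2_eq[of x y z]
          Z_eq[of "1 + x" y z] Z_eq[of 1 0 0] Z_eq[of x y z] k
        unfolding polar_def q1_eq by (simp add: algebra_simps add_divide_distrib)
    qed
    have "polar q1 u v = 0 \<longleftrightarrow> l v = 0" for v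
    proof -
      obtain x y z where v: "v = x *s u + y *s w + z *s e" using span by blast
      show ?thesis unfolding v polar l_eq using \<open>l w \<noteq> 0\<close> by simp
    qed
    moreover have "cp2_point v \<in> curve l \<longleftrightarrow> l v = 0" if "v \<noteq> 0" for v
      using that by (intro cp2_point_mem_curve_iff) (simp_all add: linear_form_smult[OF form])
    ultimately have same: "cp2_point v \<in> tangent_line q1 P \<longleftrightarrow> cp2_point v \<in> curve l" if "v \<noteq> 0" for v
      using cp2_point_mem_tangent_line_iff[OF q1(1) u(1) that] that u(2) by simp
    have "tangent_line q1 P = curve l"
    proof (rule Set.set_eqI)
      fix p
      obtain v where "v \<noteq> 0" "p = cp2_point v" by (rule cp2_point_cases)
      then show "p \<in> tangent_line q1 P \<longleftrightarrow> p \<in> curve l" using same by simp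
    qed
    moreover have "P \<in> curve l" using 0 u by (auto simp: curve_def)
    ultimately show False
      using tan[OF l] PR(1) tangent_line_linear_form[OF form] by (auto simp: tangent_at_def)
  qed
  \<comment> \<open>Finiteness of the arrangement allows one line of the pencil, that is one
    \<open>x\<close>, to serve for all lines at once.\<close>
  have "\<forall>\<^sub>F x in at_top. \<forall>l\<in>\<L>. \<forall>s. 1 / 2 \<le> cmod s \<longrightarrow> cmod s \<le> 2 \<longrightarrow>
      l (pencil_section u w e \<gamma> x s) \<noteq> 0"
    using \<L> l_ue by (intro eventually_ball_finite ballI eventually_line_avoids_section[of K]) auto
  from eventually_happens[OF eventually_conj[OF this eventually_gt_at_top[of 0]]]
  obtain x where x: "x > 0" and avoid: "\<And>l s. l \<in> \<L> \<Longrightarrow> 1 / 2 \<le> cmod s \<Longrightarrow> cmod s \<le> 2 \<Longrightarrow>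
      l (pencil_section u w e \<gamma> x s) \<noteq> 0"
    by auto
  define V where "V = pencil_section u w e \<gamma> x"
  have QV: "Q (V s) = 1" if "s \<noteq> 0" for s
    using that x k unfolding Q_def V_def pencil_section_def q2_eq by (simp add: field_simps power2_eq_square)
  have ZV: "Z (V s) = s" for s
    unfolding V_def pencil_section_def by (rule Z_eq)
  let ?\<F> = "insert q1 (insert q2 \<L>)"
  have T': "- T = - (\<Union>F\<in>?\<F>. curve F)" unfolding T by auto
  have scale: "F (c *s v) = 0 \<longleftrightarrow> F v = 0" if "F \<in> ?\<F>" "c \<noteq> 0" for F c v
    using that \<L>(2) by (auto simp: quadratic_form_smult[OF q1(1)] quadratic_form_smult[OF q2(1)] linear_form_smult[of K])
  have mem: "cp2_point v \<in> - T \<longleftrightarrow> (\<forall>F\<in>?\<F>. F v \<noteq> 0)" if "v \<noteq> 0" for v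
  proof -
    have "cp2_point v \<in> curve F \<longleftrightarrow> F v = 0" if "F \<in> ?\<F>" for F
      by (rule cp2_point_mem_curve_iff) (use scale[OF that] \<open>v \<noteq> 0\<close> in auto)
    then show ?thesis unfolding T' by auto
  qed
  show ?thesis
  proof (rule big_group_conic_pencil[OF _ _ b _ QV ZV])
    show "path_connected (- T)"
      unfolding T'
    proof (rule path_connected_Compl_curves)
      show "finite ?\<F>" "q1 \<in> ?\<F>" "q1 0 = 0" using \<L>(1) quadratic_form_0[OF q1(1)] by auto
      show "F (c *s v) = 0 \<longleftrightarrow> F v = 0" if "F \<in> ?\<F>" "c \<noteq> 0" for F c v using scale that by blast
      fix F u v assume "F \<in> ?\<F>"
      then consider "F = q1" | "F = q2" | "linear_form_over K F" using \<L>(2) by blast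
      then show "\<exists>p. \<forall>t. F (u + t *s v) = poly p t"
      proof cases
        case 3
        have "F (u + t *s v) = poly [:F u, F v:] t" for t
          by (simp add: linear_form_add[OF 3] linear_form_smult[OF 3])
        then show ?thesis by blast
      qed (use quadratic_form_line[OF q1(1)] quadratic_form_line[OF q2(1)] in blast)+
    qed
    show "- T \<subseteq> cp2_point ` Y"
    proof
      fix p assume p: "p \<in> - T"
      obtain v where v: "v \<noteq> 0" "p = cp2_point v" by (rule cp2_point_cases)
      then have nz: "Q v \<noteq> 0" "Q v + (Z v)\<^sup>2 \<noteq> 0"
        using p mem[OF v(1)] k q1_eq[of v] by (auto simp: Q_def)
      \<comment> \<open>Off the conics, dividing by a square root of \<open>Q v\<close> gives a
        representative in the double cover.\<close>
      let ?v = "(1 / csqrt (Q v)) *s v"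
      have "?v \<in> Y" using nz by (simp add: Y_def Q_smult Z_smult power_divide field_simps)
      moreover have "p = cp2_point ?v" unfolding v(2) using nz v(1) by (intro cp2_point_smult[symmetric]) auto
      ultimately show "p \<in> cp2_point ` Y" by blast
    qed
    show "continuous_on (- {0}) V"
      unfolding V_def pencil_section_def by (intro continuous_intros) (use x in auto)
    show "V (- s) = - V s" for s
    proof -
      have odd: "1 / - s - \<gamma> * - s = - (1 / s - \<gamma> * s)" by simp
      have "(- s * of_real x) *s u + (- a / of_real x) *s w + (- s) *s e =
          - ((s * of_real x) *s u + (a / of_real x) *s w + s *s e)" for a
        by (simp add: vec_eq_iff)
      then show ?thesis unfolding V_def pencil_section_def odd .
    qed
    fix s assume s: "1 / 2 \<le> cmod s" "cmod s \<le> 2" "1 + s\<^sup>2 \<noteq> 0"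
    then have "s \<noteq> 0" by auto
    then have "Q (V s) = 1" by (rule QV)
    then have "q2 (V s) \<noteq> 0" "q1 (V s) \<noteq> 0" "V s \<noteq> 0"
      using k s(3) ZV[of s] q1_eq[of "V s"] Q_0 by (auto simp: Q_def)
    then show "cp2_point (V s) \<in> - T" using avoid s mem by (auto simp: V_def)
  qed
qed

theorem corollary1p2:
  fixes n m :: nat
    and q1 q2 :: "complex^3 \<Rightarrow> complex"
    and l l' :: "nat \<Rightarrow> complex^3 \<Rightarrow> complex"
    and T :: "cp2 set" and b :: cp2
  assumes "smooth_conic_over \<real> q1" and "smooth_conic_over \<real> q2"
    and "curve q1 \<noteq> curve q2"
    and "card {p. tangent_at q1 q2 p} = 2"
    and "\<And>i. i < n \<Longrightarrow> line_over \<real> (l i)"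
    and "\<And>j. j < m \<Longrightarrow> line_over \<real> (l' j)"
    and "\<And>i. i < n \<Longrightarrow> tangent q1 (l i)"
    and "\<And>j. j < m \<Longrightarrow> tangent q2 (l' j)"
    and "inj_on (\<lambda>i. curve (l i)) {..<n}"
    and "inj_on (\<lambda>j. curve (l' j)) {..<m}"
    and "\<And>i j. i < n \<Longrightarrow> j < m \<Longrightarrow> curve (l i) \<noteq> curve (l' j)"
    and "\<And>i p. i < n \<Longrightarrow> tangent_at q1 q2 p \<Longrightarrow> \<not> (tangent_at q1 (l i) p \<and> tangent_at q2 (l i) p)"
    and "\<And>j p. j < m \<Longrightarrow> tangent_at q1 q2 p \<Longrightarrow> \<not> (tangent_at q1 (l' j) p \<and> tangent_at q2 (l' j) p)"
    and "T = curve q1 \<union> curve q2 \<union> (\<Union>i<n. curve (l i)) \<union> (\<Union>j<m. curve (l' j))"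
    and "b \<in> - T"
  shows "big_group (fundamental_group (- T) b)"
proof -
  \<comment> \<open>The loops shrink to \<open>P\<close>, while \<open>R\<close> is the base point
    of the pencil of lines carrying them; the two could be interchanged.\<close>
  obtain P R where PR: "{p. tangent_at q1 q2 p} = {P, R}" "P \<noteq> R"
    using assms(4) by (meson card_2_iff)
  have "P \<in> {p. tangent_at q1 q2 p}" "R \<in> {p. tangent_at q1 q2 p}" unfolding PR(1) by simp_all
  then have P: "tangent_at q1 q2 P" and R: "tangent_at q1 q2 R" by simp_all
  let ?\<L> = "l ` {..<n} \<union> l' ` {..<m}"
  show ?thesis
  proof (rule big_group_tangent_conics_and_lines[where K = "\<real>" and \<L> = ?\<L> and P = P and R = R])
    show "T = curve q1 \<union> curve q2 \<union> (\<Union>l\<in>?\<L>. curve l)" unfolding assms(14) by auto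
    show "linear_form_over \<real> g \<and> g \<noteq> (\<lambda>x. 0)" if "g \<in> ?\<L>" for g
      using that assms(5,6) by (auto simp: line_over_def)
    show "\<not> (tangent_at q1 g P \<and> tangent_at q2 g P)" if "g \<in> ?\<L>" for g
      using that assms(12,13) P by blast
    show "quadratic_form_over \<real> q1" "smooth_curve q1" "quadratic_form_over \<real> q2" "smooth_curve q2"
      using assms(1,2) by (simp_all add: smooth_conic_over_def)
  qed (use P R PR(2) assms(3,15) in simp_all)
qed

end
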